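(* Fix $\lambda\in(0,1]$, tolerances $\varepsilon>0$ and $\delta\in(0,1)$, an integer $\kappa\ge1$ and a constant $C_\partial>0$. There is a constant $C>0$, depending only on $\lambda,\varepsilon,\delta,\kappa,C_\partial$, such that the following holds. Let $n\ge 2$, let $G$ be a bounded-degree interaction graph on $n$ qubits, and let $\rho_L=\Phi_L\circ\cdots\circ\Phi_1(|0\rangle\langle0|^{\otimes n})$ with $\Phi_\ell=\mathcal D_\lambda^{\otimes n}\circ\mathcal U_\ell$, where each $\mathcal U_\ell$ is a unitary layer of local gates, each supported on at most $\kappa$ sites. Let $A\mid A^c$ be a bipartition of the vertices with boundary size $a(A)>0$ such that each layer contains at most $C_\partial\,a(A)$ gates crossing the cut. Then for every circuit depth $L\ge0$, the average boundary-bond dimensions required to approximate $\rho_L$ at absolute Hilbert-Schmidt error $\varepsilon$ and at relative error $\delta$ satisfy $$\log\overline\chi_\partial^{\mathrm{abs}}(A)\le C\log n,\qquad \log\overline\chi_\partial^{\mathrm{rel}}(A)\le C\log n .$$ Consequently both $\overline\chi_\partial^{\mathrm{abs}}(A)$ and $\overline\chi_\partial^{\mathrm{rel}}(A)$ are bounded by a polynomial in $n$, uniformly in $L$.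
   Context: $\mathcal D_\lambda(\sigma)=(1-\lambda)\sigma+\lambda\,\mathrm{tr}(\sigma)\mathbb I/2$ is single-qubit depolarizing noise; $\mathcal U_\ell(\cdot)=U_\ell(\cdot)U_\ell^\dagger$. A gate crosses the cut if its support meets both $A$ and $A^c$. Boundary size: $a(A)$ is the number of edges of $G$ with one endpoint in $A$ and the other in $A^c$. Operator Schmidt decomposition across $A\mid A^c$: $\rho=\sum_{\alpha=1}^r\lambda_\alpha L_\alpha\otimes R_\alpha$, $\lambda_1\ge\lambda_2\ge\dots>0$, with $\{L_\alpha\}$ on $A$, $\{R_\alpha\}$ on $A^c$ Hilbert-Schmidt orthonormal. Truncation to the largest $\chi$ coefficients gives $\widehat\rho_\chi=\sum_{\alpha\le\chi}\lambda_\alpha L_\alpha\otimes R_\alpha$, with squared Hilbert-Schmidt error $\|\rho-\widehat\rho_\chi\|_2^2=\sum_{\alpha>\chi}\lambda_\alpha^2$. $R_{\mathrm{abs}}$ is the least integer $\chi\ge1$ with $\|\rho-\widehat\rho_\chi\|_2^2\le\varepsilon$; $R_{\mathrm{rel}}$ is the least integer $\chi\ge1$ with $\|\rho-\widehat\rho_\chi\|_2^2\le\delta\|\rho\|_2^2$. Average boundary-bond dimensions (of $\rho=\rho_L$): $\overline\chi_\partial^{\mathrm{abs}}(A)=R_{\mathrm{abs}}^{1/a(A)}$ and $\overline\chi_\partial^{\mathrm{rel}}(A)=R_{\mathrm{rel}}^{1/a(A)}$. *)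

theory Defs
  imports Complex_Main "HOL-Computational_Algebra.Polynomial"
begin

text \<open>
  Qubits are labelled by natural numbers.  A computational basis state of a finite set \<open>S\<close> of qubits
  is encoded as the subset \<open>x \<subseteq> S\<close> of the qubits in state 1.  An operator on the qubits \<open>S\<close> is
  given by its matrix entries \<open>X x y\<close>; only the entries with \<open>x, y \<in> Pow S\<close> are meaningful.
  For disjoint \<open>S\<close>, \<open>T\<close>, the basis state of \<open>S \<union> T\<close> with restrictions \<open>x\<close> and \<open>y\<close> is \<open>x \<union> y\<close>.
\<close>

type_synonym qop = "nat set \<Rightarrow> nat set \<Rightarrow> complex"

definition id_op :: qop where
  "id_op x y = (if x = y then 1 else 0)"

definition op_mult :: "nat set \<Rightarrow> qop \<Rightarrow> qop \<Rightarrow> qop" where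
  "op_mult S X Y = (\<lambda>x y. \<Sum>z\<in>Pow S. X x z * Y z y)"

definition op_adj :: "qop \<Rightarrow> qop" where
  "op_adj X = (\<lambda>x y. cnj (X y x))"

definition op_tr :: "nat set \<Rightarrow> qop \<Rightarrow> complex" where
  "op_tr S X = (\<Sum>x\<in>Pow S. X x x)"

definition op_eq :: "nat set \<Rightarrow> qop \<Rightarrow> qop \<Rightarrow> bool" where
  "op_eq S X Y \<longleftrightarrow> (\<forall>x\<in>Pow S. \<forall>y\<in>Pow S. X x y = Y x y)"

definition op_unitary :: "nat set \<Rightarrow> qop \<Rightarrow> bool" where
  "op_unitary S U \<longleftrightarrow>
     op_eq S (op_mult S (op_adj U) U) id_op \<and> op_eq S (op_mult S U (op_adj U)) id_op"

text \<open>Tensor product of an operator on \<open>A\<close> with an operator on the qubits outside \<open>A\<close>.\<close>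

definition op_tensor :: "nat set \<Rightarrow> qop \<Rightarrow> qop \<Rightarrow> qop" where
  "op_tensor A X Y = (\<lambda>x y. X (x \<inter> A) (y \<inter> A) * Y (x - A) (y - A))"

definition hs_inner :: "nat set \<Rightarrow> qop \<Rightarrow> qop \<Rightarrow> complex" where
  "hs_inner S X Y = op_tr S (op_mult S (op_adj X) Y)"

definition hs_norm :: "nat set \<Rightarrow> qop \<Rightarrow> real" where
  "hs_norm S X = sqrt (Re (hs_inner S X X))"

definition hs_orthonormal :: "nat set \<Rightarrow> nat set \<Rightarrow> (nat \<Rightarrow> qop) \<Rightarrow> bool" where
  "hs_orthonormal S I X \<longleftrightarrow>
     (\<forall>\<alpha>\<in>I. \<forall>\<beta>\<in>I. hs_inner S (X \<alpha>) (X \<beta>) = (if \<alpha> = \<beta> then 1 else 0))"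


subsection \<open>Depolarizing noise\<close>

type_synonym qubit_op = "bool \<Rightarrow> bool \<Rightarrow> complex"

definition depol :: "real \<Rightarrow> qubit_op \<Rightarrow> qubit_op" where
  "depol lam \<sigma> = (\<lambda>a b. complex_of_real (1 - lam) * \<sigma> a b
      + complex_of_real lam * (\<Sum>c\<in>UNIV. \<sigma> c c) * (if a = b then 1 else 0) / 2)"

definition set_bit_of :: "nat \<Rightarrow> bool \<Rightarrow> nat set \<Rightarrow> nat set" where
  "set_bit_of i b x = (if b then insert i x else x - {i})"

text \<open>
  The map \<open>F\<close> on qubit \<open>i\<close>, tensored with the identity map on all other qubits: \<open>F\<close> (linear) is
  applied to each single-qubit block obtained by fixing the matrix indices of the other qubits.
\<close>

definition on_qubit :: "nat \<Rightarrow> (qubit_op \<Rightarrow> qubit_op) \<Rightarrow> qop \<Rightarrow> qop" where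
  "on_qubit i F \<rho> =
     (\<lambda>x y. F (\<lambda>a b. \<rho> (set_bit_of i a x) (set_bit_of i b y)) (i \<in> x) (i \<in> y))"

text \<open>The tensor power of \<open>F\<close> is the composition of its (commuting) single-qubit actions.\<close>

definition tensor_power_map :: "nat \<Rightarrow> (qubit_op \<Rightarrow> qubit_op) \<Rightarrow> qop \<Rightarrow> qop" where
  "tensor_power_map n F \<rho> = fold (\<lambda>i. on_qubit i F) [0..<n] \<rho>"


subsection \<open>Noisy circuits\<close>

text \<open>A gate is a pair of its support and its matrix on that support.\<close>

type_synonym gate = "nat set \<times> qop"

definition gate_op :: "gate \<Rightarrow> qop" where
  "gate_op g = op_tensor (fst g) (snd g) id_op"

definition local_gate :: "nat \<Rightarrow> nat \<Rightarrow> gate \<Rightarrow> bool" where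
  "local_gate n \<kappa> g \<longleftrightarrow>
     fst g \<subseteq> {..<n} \<and> card (fst g) \<le> \<kappa> \<and> op_unitary (fst g) (snd g)"

definition crosses :: "nat set \<Rightarrow> gate \<Rightarrow> bool" where
  "crosses A g \<longleftrightarrow> fst g \<inter> A \<noteq> {} \<and> fst g - A \<noteq> {}"

text \<open>
  A layer is a list of gates, the head of the list acting first.  Supports within a layer need not
  be disjoint; if they are, the order is irrelevant.
\<close>

definition layer_op :: "nat \<Rightarrow> gate list \<Rightarrow> qop" where
  "layer_op n gs = fold (\<lambda>g U. op_mult {..<n} (gate_op g) U) gs id_op"

definition conj_map :: "nat \<Rightarrow> qop \<Rightarrow> qop \<Rightarrow> qop" where
  "conj_map n U \<rho> = op_mult {..<n} (op_mult {..<n} U \<rho>) (op_adj U)"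

definition noisy_layer :: "nat \<Rightarrow> real \<Rightarrow> gate list \<Rightarrow> qop \<Rightarrow> qop" where
  "noisy_layer n lam gs \<rho> = tensor_power_map n (depol lam) (conj_map n (layer_op n gs) \<rho>)"

definition zero_state :: qop where
  "zero_state x y = (if x = {} \<and> y = {} then 1 else 0)"

primrec noisy_state :: "nat \<Rightarrow> real \<Rightarrow> (nat \<Rightarrow> gate list) \<Rightarrow> nat \<Rightarrow> qop" where
  "noisy_state n lam layers 0 = zero_state"
| "noisy_state n lam layers (Suc l) =
     noisy_layer n lam (layers (Suc l)) (noisy_state n lam layers l)"


subsection \<open>Interaction graphs\<close>

definition simple_graph :: "nat \<Rightarrow> nat set set \<Rightarrow> bool" where
  "simple_graph n E \<longleftrightarrow> (\<forall>e\<in>E. e \<subseteq> {..<n} \<and> card e = 2)"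

definition degree_bounded :: "nat \<Rightarrow> nat set set \<Rightarrow> nat \<Rightarrow> bool" where
  "degree_bounded n E d \<longleftrightarrow> (\<forall>v<n. card {e\<in>E. v \<in> e} \<le> d)"

definition boundary_size :: "nat set set \<Rightarrow> nat set \<Rightarrow> nat" where
  "boundary_size E A = card {e\<in>E. e \<inter> A \<noteq> {} \<and> e - A \<noteq> {}}"


subsection \<open>Operator Schmidt decomposition and bond dimensions\<close>

definition schmidt_sum ::
  "nat set \<Rightarrow> nat \<Rightarrow> (nat \<Rightarrow> real) \<Rightarrow> (nat \<Rightarrow> qop) \<Rightarrow> (nat \<Rightarrow> qop) \<Rightarrow> qop" where
  "schmidt_sum A r s X Y =
     (\<lambda>x y. \<Sum>\<alpha>=1..r. complex_of_real (s \<alpha>) * op_tensor A (X \<alpha>) (Y \<alpha>) x y)"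

definition schmidt_decomposition ::
  "nat \<Rightarrow> nat set \<Rightarrow> qop \<Rightarrow> nat \<Rightarrow> (nat \<Rightarrow> real) \<Rightarrow> (nat \<Rightarrow> qop) \<Rightarrow> (nat \<Rightarrow> qop) \<Rightarrow> bool" where
  "schmidt_decomposition n A \<rho> r s X Y \<longleftrightarrow>
     op_eq {..<n} \<rho> (schmidt_sum A r s X Y) \<and>
     (\<forall>\<alpha>\<in>{1..r}. 0 < s \<alpha>) \<and>
     (\<forall>\<alpha>\<in>{1..r}. \<forall>\<beta>\<in>{1..r}. \<alpha> \<le> \<beta> \<longrightarrow> s \<beta> \<le> s \<alpha>) \<and>
     hs_orthonormal A {1..r} X \<and> hs_orthonormal ({..<n} - A) {1..r} Y"

text \<open>
  \<open>trunc_error_le n A \<rho> \<chi> t\<close>: truncating an operator Schmidt decomposition of \<open>\<rho>\<close> to its largest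
  \<open>\<chi>\<close> coefficients has squared error at most \<open>t\<close>.  The decomposition is not unique, but the
  coefficients and hence the error are.
\<close>

definition trunc_error_le :: "nat \<Rightarrow> nat set \<Rightarrow> qop \<Rightarrow> nat \<Rightarrow> real \<Rightarrow> bool" where
  "trunc_error_le n A \<rho> \<chi> t \<longleftrightarrow>
     (\<exists>r s X Y. schmidt_decomposition n A \<rho> r s X Y \<and>
        (hs_norm {..<n} (\<lambda>x y. \<rho> x y - schmidt_sum A (min \<chi> r) s X Y x y))\<^sup>2 \<le> t)"

definition R_abs :: "nat \<Rightarrow> nat set \<Rightarrow> real \<Rightarrow> qop \<Rightarrow> nat" where
  "R_abs n A \<epsilon> \<rho> = (LEAST \<chi>. 1 \<le> \<chi> \<and> trunc_error_le n A \<rho> \<chi> \<epsilon>)"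

definition R_rel :: "nat \<Rightarrow> nat set \<Rightarrow> real \<Rightarrow> qop \<Rightarrow> nat" where
  "R_rel n A \<delta> \<rho> = (LEAST \<chi>. 1 \<le> \<chi> \<and> trunc_error_le n A \<rho> \<chi> (\<delta> * (hs_norm {..<n} \<rho>)\<^sup>2))"

definition bond_dim_abs :: "nat \<Rightarrow> nat set set \<Rightarrow> nat set \<Rightarrow> real \<Rightarrow> qop \<Rightarrow> real" where
  "bond_dim_abs n E A \<epsilon> \<rho> = real (R_abs n A \<epsilon> \<rho>) powr (1 / real (boundary_size E A))"

definition bond_dim_rel :: "nat \<Rightarrow> nat set set \<Rightarrow> nat set \<Rightarrow> real \<Rightarrow> qop \<Rightarrow> real" where
  "bond_dim_rel n E A \<delta> \<rho> = real (R_rel n A \<delta> \<rho>) powr (1 / real (boundary_size E A))"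

end

theory Submission
  imports Defs "HOL-Analysis.Analysis"
begin

text \<open>
  The operator Schmidt rank grows by a factor of at most \<open>16\<^sup>\<kappa>\<close> per crossing gate, which settles depths \<open>L\<close> of
  order \<open>log n\<close>.  For larger depths the state is so close to maximally mixed that one Schmidt term suffices:
  the purity \<open>f = 2\<^sup>n tr \<rho>\<^sup>2\<close> satisfies \<open>f \<mapsto> f' \<le> f\<^sup>\<gamma>\<close> in every layer with a constant \<open>\<gamma> < 1\<close>, whence
  \<open>f \<le> 2 powr (n \<gamma>\<^sup>L)\<close> is at most \<open>1 + \<theta>\<close> once \<open>L\<close> exceeds a multiple of \<open>log n\<close>.

  The contraction comes from hypercontractivity.  Let \<open>T\<^sub>r\<close> be the noise with \<open>\<lambda> = 1 - r\<close> and \<open>Y = T\<^sub>r \<rho>\<close>.  Then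
  \<open>(tr \<rho> Y)\<^sup>2 \<le> tr \<rho> Y\<^sup>2 \<le> \<parallel>\<rho>\<parallel> \<parallel>Y\<^sup>2\<parallel>\<close>, and for small \<open>r\<close> a quantum Bonami lemma, proved by induction on the
  number of qubits, bounds \<open>\<parallel>Y\<^sup>2\<parallel>\<close> by \<open>\<parallel>\<rho>\<parallel>\<^sup>2\<close>; this gives \<open>2\<^sup>n tr \<rho> T\<^sub>r \<rho> \<le> f powr (3/4)\<close>.  Weaker noise is reached by
  iterating \<open>\<parallel>T\<^sub>q \<rho>\<parallel>\<^sup>2 \<le> \<parallel>\<rho>\<parallel> \<parallel>T\<^sub>s \<rho>\<parallel>\<close> with \<open>s = q\<^sup>2\<close>.
\<close>

section \<open>Hilbert-Schmidt calculus\<close>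

text \<open>Contracting the distance to the maximally mixed state is too slow. Noise shrinks each
  non-identity Pauli component at least by the factor \<open>1 - lam\<close>, which gives f - 1 <=
  (1 - lam)^(2L) 2^n; starting from f = 2^n this asks for L of order n, and the rank bound at such
  depths allows bond dimensions exponential in n. What has to shrink by a constant factor is log f,
  and a gain in the exponent is what hypercontractivity provides. Since any constant \<gamma> < 1
  will do, the Bonami inequality may be crude: its threshold r^2 <= 1/8 only has to be some positive
  constant. Near the maximally mixed state one Schmidt term suffices because the identity is a
  product operator across every cut. The bond dimensions are least numbers for which a decomposition
  with small truncation error exists, so a Schmidt decomposition with few terms has to be exhibited.
  It is built from an arbitrary expansion into product operators, so that the bound on the number of
  terms survives.\<close>

lemma hs_inner_eq: "hs_inner S X Y = (\<Sum>x\<in>Pow S. \<Sum>y\<in>Pow S. cnj (X x y) * Y x y)"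
  unfolding hs_inner_def op_tr_def op_mult_def op_adj_def by (rule sum.swap)

lemma hs_inner_self: "hs_inner S X X = of_real (\<Sum>x\<in>Pow S. \<Sum>y\<in>Pow S. (cmod (X x y))\<^sup>2)"
  unfolding hs_inner_eq by (simp only: of_real_sum complex_norm_square mult.commute)

lemma hs_norm_square: "(hs_norm S X)\<^sup>2 = (\<Sum>x\<in>Pow S. \<Sum>y\<in>Pow S. (cmod (X x y))\<^sup>2)"
  unfolding hs_norm_def hs_inner_self Re_complex_of_real by (simp add: sum_nonneg)

lemma hs_inner_self_norm: "hs_inner S X X = of_real ((hs_norm S X)\<^sup>2)"
  unfolding hs_inner_self hs_norm_square ..

lemma hs_norm_nonneg [simp]: "0 \<le> hs_norm S X"
  unfolding hs_norm_def hs_inner_self by (simp add: sum_nonneg)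

text \<open>Flattening the matrix to a vector turns the triangle and Cauchy-Schwarz inequalities
  below into instances of the facts on \<open>L2_set\<close>.\<close>

lemma hs_norm_eq_L2_set: "hs_norm S X = L2_set (\<lambda>(x, y). cmod (X x y)) (Pow S \<times> Pow S)"
  unfolding hs_norm_def hs_inner_self L2_set_def by (simp add: sum.cartesian_product case_prod_beta)

lemma hs_norm_cong: "op_eq S X Y \<Longrightarrow> hs_norm S X = hs_norm S Y"
  unfolding hs_norm_eq_L2_set op_eq_def by (intro L2_set_cong) auto

lemma hs_inner_cong: "op_eq S X X' \<Longrightarrow> op_eq S Y Y' \<Longrightarrow> hs_inner S X Y = hs_inner S X' Y'"
  unfolding hs_inner_eq op_eq_def by (intro sum.cong) auto

lemma hs_norm_triangle: "hs_norm S (\<lambda>x y. X x y + Y x y) \<le> hs_norm S X + hs_norm S Y"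
proof -
  have "hs_norm S (\<lambda>x y. X x y + Y x y)
      \<le> L2_set (\<lambda>p. cmod (X (fst p) (snd p)) + cmod (Y (fst p) (snd p))) (Pow S \<times> Pow S)"
    unfolding hs_norm_eq_L2_set by (rule L2_set_mono) (auto simp: norm_triangle_ineq)
  also have "\<dots> \<le> hs_norm S X + hs_norm S Y"
    unfolding hs_norm_eq_L2_set case_prod_beta by (rule L2_set_triangle_ineq)
  finally show ?thesis .
qed

lemma hs_norm_scale: "hs_norm S (\<lambda>x y. c * X x y) = cmod c * hs_norm S X"
  unfolding hs_norm_eq_L2_set case_prod_beta by (simp add: L2_set_right_distrib norm_mult)

lemma hs_norm_uminus: "hs_norm S (\<lambda>x y. - X x y) = hs_norm S X"
  unfolding hs_norm_eq_L2_set by simp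

lemma hs_norm_triangle_diff: "hs_norm S (\<lambda>x y. X x y - Y x y) \<le> hs_norm S X + hs_norm S Y"
  using hs_norm_triangle[of S X "\<lambda>x y. - Y x y"] by (simp add: hs_norm_uminus)

lemma hs_cauchy_schwarz: "cmod (hs_inner S X Y) \<le> hs_norm S X * hs_norm S Y"
proof -
  have "cmod (hs_inner S X Y) \<le> (\<Sum>p\<in>Pow S \<times> Pow S. \<bar>cmod (X (fst p) (snd p))\<bar> * \<bar>cmod (Y (fst p) (snd p))\<bar>)"
    unfolding hs_inner_eq sum.cartesian_product case_prod_beta
    by (rule order_trans[OF norm_sum]) (simp add: norm_mult)
  also have "\<dots> \<le> hs_norm S X * hs_norm S Y"
    unfolding hs_norm_eq_L2_set case_prod_beta by (rule L2_set_mult_ineq)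
  finally show ?thesis .
qed

lemma hs_inner_commute: "hs_inner S X Y = cnj (hs_inner S Y X)"
  by (simp add: hs_inner_eq mult.commute)

lemma hs_inner_add_right: "hs_inner S X (\<lambda>x y. Y x y + Z x y) = hs_inner S X Y + hs_inner S X Z"
  by (simp add: hs_inner_eq distrib_left sum.distrib)

lemma hs_inner_diff_right: "hs_inner S X (\<lambda>x y. Y x y - Z x y) = hs_inner S X Y - hs_inner S X Z"
  by (simp add: hs_inner_eq right_diff_distrib sum_subtractf)

lemma hs_inner_scale_right: "hs_inner S X (\<lambda>x y. c * Y x y) = c * hs_inner S X Y"
  by (simp add: hs_inner_eq sum_distrib_left mult.left_commute)

lemma hs_inner_add_left: "hs_inner S (\<lambda>x y. Y x y + Z x y) X = hs_inner S Y X + hs_inner S Z X"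
  by (simp add: hs_inner_eq distrib_right sum.distrib)

lemma hs_inner_diff_left: "hs_inner S (\<lambda>x y. Y x y - Z x y) X = hs_inner S Y X - hs_inner S Z X"
  by (simp add: hs_inner_eq left_diff_distrib sum_subtractf)

lemma hs_inner_scale_left: "hs_inner S (\<lambda>x y. c * Y x y) X = cnj c * hs_inner S Y X"
  by (simp add: hs_inner_eq sum_distrib_left mult.assoc)

lemma op_adj_adj [simp]: "op_adj (op_adj X) = X"
  by (simp add: op_adj_def)

lemma op_mult_assoc: "op_mult S (op_mult S X Y) Z = op_mult S X (op_mult S Y Z)"
proof (intro ext)
  fix x y
  show "op_mult S (op_mult S X Y) Z x y = op_mult S X (op_mult S Y Z) x y"
    unfolding op_mult_def sum_distrib_left sum_distrib_right
    by (subst sum.swap) (simp add: mult.assoc)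
qed

lemma op_adj_mult: "op_adj (op_mult S X Y) = op_mult S (op_adj Y) (op_adj X)"
  by (simp add: op_adj_def op_mult_def fun_eq_iff mult.commute)

lemma hs_norm_adj [simp]: "hs_norm S (op_adj X) = hs_norm S X"
proof -
  have "(hs_norm S (op_adj X))\<^sup>2 = (hs_norm S X)\<^sup>2"
    unfolding hs_norm_square op_adj_def by (subst sum.swap) simp
  then show ?thesis by (simp add: power2_eq_iff_nonneg)
qed

lemma op_tr_mult_commute: "op_tr S (op_mult S X Y) = op_tr S (op_mult S Y X)"
  unfolding op_tr_def op_mult_def by (subst sum.swap) (simp add: mult.commute)

lemma hs_inner_mult_left:
  "hs_inner S (op_mult S A X) Y = hs_inner S X (op_mult S (op_adj A) Y)"
  by (simp add: hs_inner_def op_adj_mult op_mult_assoc)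

lemma hs_inner_mult_right:
  "hs_inner S (op_mult S X A) Y = hs_inner S X (op_mult S Y (op_adj A))"
  unfolding hs_inner_def op_adj_mult
  by (subst op_mult_assoc, subst op_tr_mult_commute) (simp add: op_mult_assoc)

lemma hs_norm_gram_adj:
  "hs_norm S (op_mult S (op_adj X) X) = hs_norm S (op_mult S X (op_adj X))"
proof -
  have "hs_inner S (op_mult S (op_adj X) X) (op_mult S (op_adj X) X)
      = hs_inner S (op_mult S X (op_adj X)) (op_mult S X (op_adj X))"
    by (subst hs_inner_mult_left, subst hs_inner_mult_right) (simp add: op_mult_assoc)
  then show ?thesis by (simp add: hs_norm_def)
qed

text \<open>Hoelder's inequality for the Schatten 4-norm, whose square is the norm of
  \<open>op_mult S (op_adj X) X\<close>. By cyclicity of the trace the left side is the inner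
  product of the two Gram operators in the opposite order, so Cauchy-Schwarz applies, and
  \<open>hs_norm_gram_adj\<close> restores the order.\<close>

lemma hs_norm_adj_mult_le:
  "(hs_norm S (op_mult S (op_adj X) Y))\<^sup>2
     \<le> hs_norm S (op_mult S (op_adj X) X) * hs_norm S (op_mult S (op_adj Y) Y)"
proof -
  have "hs_inner S (op_mult S (op_adj X) Y) (op_mult S (op_adj X) Y)
      = hs_inner S (op_mult S Y (op_adj Y)) (op_mult S X (op_adj X))"
    by (subst hs_inner_mult_left, subst hs_inner_mult_right) (simp add: op_mult_assoc)
  then have "(hs_norm S (op_mult S (op_adj X) Y))\<^sup>2
      = cmod (hs_inner S (op_mult S Y (op_adj Y)) (op_mult S X (op_adj X)))"
    by (metis hs_inner_self_norm norm_of_real abs_of_nonneg zero_le_power2)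
  also have "\<dots> \<le> hs_norm S (op_mult S Y (op_adj Y)) * hs_norm S (op_mult S X (op_adj X))"
    by (rule hs_cauchy_schwarz)
  finally show ?thesis by (simp add: hs_norm_gram_adj mult.commute)
qed

lemma op_mult_add_left: "op_mult S (\<lambda>x y. X x y + Y x y) Z = (\<lambda>x y. op_mult S X Z x y + op_mult S Y Z x y)"
  by (simp add: op_mult_def distrib_right sum.distrib)

lemma op_mult_add_right: "op_mult S Z (\<lambda>x y. X x y + Y x y) = (\<lambda>x y. op_mult S Z X x y + op_mult S Z Y x y)"
  by (simp add: op_mult_def distrib_left sum.distrib)

lemma op_mult_diff_right: "op_mult S Z (\<lambda>x y. X x y - Y x y) = (\<lambda>x y. op_mult S Z X x y - op_mult S Z Y x y)"
  by (simp add: op_mult_def right_diff_distrib sum_subtractf)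

lemma op_mult_diff_left: "op_mult S (\<lambda>x y. X x y - Y x y) Z = (\<lambda>x y. op_mult S X Z x y - op_mult S Y Z x y)"
  by (simp add: op_mult_def left_diff_distrib sum_subtractf)

lemma op_mult_scale_left: "op_mult S (\<lambda>x y. c * X x y) Z = (\<lambda>x y. c * op_mult S X Z x y)"
  by (simp add: op_mult_def sum_distrib_left mult.assoc)

lemma op_mult_scale_right: "op_mult S Z (\<lambda>x y. c * X x y) = (\<lambda>x y. c * op_mult S Z X x y)"
  by (simp add: op_mult_def sum_distrib_left mult.left_commute)

lemma op_mult_cong: "op_eq S X X' \<Longrightarrow> op_eq S Y Y' \<Longrightarrow> op_eq S (op_mult S X Y) (op_mult S X' Y')"
  by (auto simp: op_eq_def op_mult_def intro!: sum.cong)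

lemma op_mult_id_left: "finite S \<Longrightarrow> op_eq S (op_mult S id_op X) X"
  by (simp add: op_eq_def op_mult_def id_op_def if_distrib if_distribR sum.delta cong: if_cong)

lemma op_mult_id_right: "finite S \<Longrightarrow> op_eq S (op_mult S X id_op) X"
  by (simp add: op_eq_def op_mult_def id_op_def if_distrib if_distribR sum.delta' cong: if_cong)

lemma op_adj_id [simp]: "op_adj id_op = id_op"
  by (auto simp: op_adj_def id_op_def fun_eq_iff)

lemma op_eq_trans: "op_eq S X Y \<Longrightarrow> op_eq S Y Z \<Longrightarrow> op_eq S X Z"
  by (simp add: op_eq_def)

lemma op_eq_refl [simp]: "op_eq S X X"
  by (simp add: op_eq_def)

lemma op_tr_cong: "op_eq S X Y \<Longrightarrow> op_tr S X = op_tr S Y"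
  by (auto simp: op_eq_def op_tr_def intro!: sum.cong)

section \<open>Trace and norm under unitary conjugation\<close>

lemma op_tr_conj_unitary:
  assumes "finite S" "op_eq S (op_mult S (op_adj U) U) id_op"
  shows "op_tr S (op_mult S (op_mult S U X) (op_adj U)) = op_tr S X"
proof -
  have "op_tr S (op_mult S (op_mult S U X) (op_adj U)) = op_tr S (op_mult S (op_mult S (op_adj U) U) X)"
    by (subst op_tr_mult_commute) (simp add: op_mult_assoc)
  also have "\<dots> = op_tr S (op_mult S id_op X)"
    by (intro op_tr_cong op_mult_cong assms op_eq_refl)
  also have "\<dots> = op_tr S X"
    by (intro op_tr_cong op_mult_id_left assms)
  finally show ?thesis .
qed

lemma hs_norm_unitary_left:
  assumes "finite S" "op_eq S (op_mult S (op_adj U) U) id_op"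
  shows "hs_norm S (op_mult S U X) = hs_norm S X"
proof -
  have "hs_inner S (op_mult S U X) (op_mult S U X) = hs_inner S X (op_mult S (op_mult S (op_adj U) U) X)"
    by (simp add: hs_inner_mult_left op_mult_assoc)
  also have "\<dots> = hs_inner S X X"
    using assms by (meson hs_inner_cong op_eq_refl op_eq_trans op_mult_cong op_mult_id_left)
  finally show ?thesis by (simp add: hs_norm_def)
qed

lemma hs_norm_conj_unitary:
  assumes "finite S" "op_eq S (op_mult S (op_adj U) U) id_op"
  shows "hs_norm S (op_mult S (op_mult S U X) (op_adj U)) = hs_norm S X"
proof -
  have "hs_norm S (op_mult S (op_mult S U X) (op_adj U)) = hs_norm S (op_mult S U (op_adj (op_mult S U X)))"
    by (subst hs_norm_adj[symmetric]) (simp add: op_adj_mult)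
  then show ?thesis using assms by (simp add: hs_norm_unitary_left)
qed

text \<open>Because \<open>V\<close> enters with opposite signs, the two cross terms combine into
  one inner product with \<open>U - W\<close>. In the application \<open>U\<close> and
  \<open>W\<close> share their dominant part, so this difference is small, whereas separate triangle
  inequalities would leave a term of first order in the noise parameter.\<close>

lemma hs_norm_pair_le:
  "(hs_norm S (\<lambda>x y. U x y + V x y))\<^sup>2 + (hs_norm S (\<lambda>x y. W x y - V x y))\<^sup>2
     \<le> (hs_norm S U)\<^sup>2 + (hs_norm S W)\<^sup>2 + 2 * (hs_norm S V)\<^sup>2
        + 2 * (hs_norm S V * hs_norm S (\<lambda>x y. U x y - W x y))"
proof -
  have sq: "(hs_norm S X)\<^sup>2 = Re (hs_inner S X X)" for X
    by (simp add: hs_inner_self_norm)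
  have "(hs_norm S (\<lambda>x y. U x y + V x y))\<^sup>2 + (hs_norm S (\<lambda>x y. W x y - V x y))\<^sup>2
      = (hs_norm S U)\<^sup>2 + (hs_norm S W)\<^sup>2 + 2 * (hs_norm S V)\<^sup>2
        + 2 * Re (hs_inner S V (\<lambda>x y. U x y - W x y))"
    unfolding sq using hs_inner_commute[of S U V] hs_inner_commute[of S W V]
    by (simp add: hs_inner_add_left hs_inner_add_right hs_inner_diff_left hs_inner_diff_right)
  moreover have "Re (hs_inner S V (\<lambda>x y. U x y - W x y)) \<le> hs_norm S V * hs_norm S (\<lambda>x y. U x y - W x y)"
    by (meson complex_Re_le_cmod hs_cauchy_schwarz order_trans)
  ultimately show ?thesis by linarith
qed

section \<open>Tensor products across a bipartition\<close>

lemma sum_Pow_split: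
  assumes "finite S" "T \<subseteq> S"
  shows "(\<Sum>z\<in>Pow S. h (z \<inter> T) (z - T)) = (\<Sum>p\<in>Pow T. \<Sum>q\<in>Pow (S - T). h p q)"
  unfolding sum.cartesian_product using assms
  by (intro sum.reindex_bij_witness[of _ "\<lambda>(p, q). p \<union> q" "\<lambda>z. (z \<inter> T, z - T)"])
    (auto intro!: arg_cong2[where f = h])

lemma op_tensor_mult:
  assumes "finite S" "T \<subseteq> S"
  shows "op_mult S (op_tensor T X Y) (op_tensor T X' Y') = op_tensor T (op_mult T X X') (op_mult (S - T) Y Y')"
proof (intro ext)
  fix x y
  have "op_mult S (op_tensor T X Y) (op_tensor T X' Y') x y
      = (\<Sum>z\<in>Pow S. (X (x \<inter> T) (z \<inter> T) * X' (z \<inter> T) (y \<inter> T)) * (Y (x - T) (z - T) * Y' (z - T) (y - T)))"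
    by (simp add: op_mult_def op_tensor_def mult_ac)
  also have "\<dots> = op_tensor T (op_mult T X X') (op_mult (S - T) Y Y') x y"
    by (subst sum_Pow_split[OF assms]) (simp add: op_tensor_def op_mult_def sum_product)
  finally show "op_mult S (op_tensor T X Y) (op_tensor T X' Y') x y
      = op_tensor T (op_mult T X X') (op_mult (S - T) Y Y') x y" .
qed

lemma op_adj_tensor: "op_adj (op_tensor T X Y) = op_tensor T (op_adj X) (op_adj Y)"
  by (simp add: op_adj_def op_tensor_def)

lemma op_tensor_id: "op_tensor T id_op id_op = id_op"
proof (intro ext)
  fix x y :: "nat set"
  have "x = y \<longleftrightarrow> x \<inter> T = y \<inter> T \<and> x - T = y - T" by blast
  then show "op_tensor T id_op id_op x y = id_op x y"
    by (simp add: op_tensor_def id_op_def)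
qed

lemma hs_inner_tensor:
  assumes "finite S" "T \<subseteq> S"
  shows "hs_inner S (op_tensor T X Y) (op_tensor T X' Y') = hs_inner T X X' * hs_inner (S - T) Y Y'"
  unfolding hs_inner_def op_adj_tensor op_tensor_mult[OF assms] op_tr_def
  by (simp add: op_tensor_def[abs_def] sum_Pow_split[OF assms, where h = "\<lambda>p q. X'' p p * Y'' q q" for X'' Y'']
      sum_product)

lemma hs_norm_id: "finite S \<Longrightarrow> (hs_norm S id_op)\<^sup>2 = 2 ^ card S"
proof -
  assume "finite S"
  moreover have "(cmod (id_op x y))\<^sup>2 = (if x = y then 1 else 0)" for x y
    by (simp add: id_op_def)
  ultimately show ?thesis
    by (simp add: hs_norm_square sum.delta card_Pow)
qed

lemma op_tr_eq_hs_inner_id: "finite S \<Longrightarrow> op_tr S X = hs_inner S id_op X"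
  by (simp add: hs_inner_eq op_tr_def id_op_def if_distrib if_distribR sum.delta cong: if_cong)

section \<open>Depolarizing noise\<close>

lemma set_bit_of_simps [simp]:
  "set_bit_of i (i \<in> x) x = x"
  "set_bit_of i a (set_bit_of i b x) = set_bit_of i a x"
  "i \<in> set_bit_of i b x \<longleftrightarrow> b"
  "i \<noteq> j \<Longrightarrow> j \<in> set_bit_of i b x \<longleftrightarrow> j \<in> x"
  by (auto simp: set_bit_of_def)

lemma set_bit_of_commute: "i \<noteq> j \<Longrightarrow> set_bit_of i a (set_bit_of j b x) = set_bit_of j b (set_bit_of i a x)"
  by (auto simp: set_bit_of_def)

lemma sum_Pow_bit:
  assumes "finite S" "i \<in> S"
  shows "(\<Sum>x\<in>Pow S. h x) = (\<Sum>x\<in>Pow (S - {i}). h (set_bit_of i False x) + h (set_bit_of i True x))"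
proof -
  define S' where "S' = S - {i}"
  have S: "S = insert i S'" "i \<notin> S'" "finite S'"
    using assms by (auto simp: S'_def)
  have disj: "Pow S' \<inter> insert i ` Pow S' = {}"
    using S by auto
  have "(\<Sum>x\<in>Pow S. h x) = (\<Sum>x\<in>Pow S'. h x) + (\<Sum>x\<in>insert i ` Pow S'. h x)"
    unfolding S(1) Pow_insert using S disj by (intro sum.union_disjoint) auto
  also have "(\<Sum>x\<in>insert i ` Pow S'. h x) = (\<Sum>x\<in>Pow S'. h (insert i x))"
    using S by (subst sum.reindex) (auto simp: inj_on_def)
  also have "(\<Sum>x\<in>Pow S'. h x) = (\<Sum>x\<in>Pow S'. h (set_bit_of i False x))"
    using S by (intro sum.cong) (auto simp: set_bit_of_def intro!: arg_cong[where f = h])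
  finally show ?thesis
    by (simp add: set_bit_of_def S'_def sum.distrib)
qed

lemma on_qubit_depol:
  "on_qubit i (depol lam) X x y = of_real (1 - lam) * X x y +
     (if (i \<in> x) = (i \<in> y) then of_real lam *
       (X (set_bit_of i False x) (set_bit_of i False y) + X (set_bit_of i True x) (set_bit_of i True y)) / 2 else 0)"
  by (simp add: on_qubit_def depol_def UNIV_bool)

text \<open>Written as \<open>depol (1 - p)\<close>, the parameter \<open>p\<close> is the factor
  applied to the traceless part of the qubit, and such factors multiply. Later statements use this
  parametrization for that reason.\<close>

lemma on_qubit_depol_comp:
  "on_qubit i (depol (1 - p)) (on_qubit i (depol (1 - q)) X) = on_qubit i (depol (1 - p * q)) X"
  by (auto simp: on_qubit_depol fun_eq_iff field_simps)

lemma on_qubit_depol_commute: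
  "on_qubit i (depol p) (on_qubit j (depol q) X) = on_qubit j (depol q) (on_qubit i (depol p) X)"
proof (cases "i = j")
  case True
  then show ?thesis
    using on_qubit_depol_comp[of i "1 - p" "1 - q" X] on_qubit_depol_comp[of i "1 - q" "1 - p" X]
    by (simp add: mult.commute)
next
  case False
  \<comment> \<open>\<open>avg k\<close> replaces qubit \<open>k\<close> by the maximally mixed
    state. Noise is an affine combination of it with the identity map, so it is enough that averages
    over distinct qubits commute.\<close>
  define avg :: "nat \<Rightarrow> qop \<Rightarrow> qop" where
    "avg k Z x y = (if (k \<in> x) = (k \<in> y) then (Z (set_bit_of k False x) (set_bit_of k False y)
       + Z (set_bit_of k True x) (set_bit_of k True y)) / 2 else 0)" for k Z x y
  have depol_avg: "on_qubit k (depol l) Z = (\<lambda>x y. of_real (1 - l) * Z x y + of_real l * avg k Z x y)" for k l Z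
    by (simp add: on_qubit_depol avg_def fun_eq_iff)
  have avg_linear: "avg k (\<lambda>x y. c * Z x y + d * W x y) = (\<lambda>x y. c * avg k Z x y + d * avg k W x y)" for k c d Z W
    by (auto simp: avg_def fun_eq_iff algebra_simps add_divide_distrib)
  have avg_commute: "avg i (avg j X) = avg j (avg i X)"
    using False by (auto simp: avg_def fun_eq_iff set_bit_of_commute[of i j] add_divide_distrib)
  show ?thesis
    unfolding depol_avg avg_linear avg_commute by (simp add: algebra_simps)
qed

lemma on_qubit_depol_linear:
  "on_qubit i (depol lam) (\<lambda>x y. c * X x y + d * Y x y)
     = (\<lambda>x y. c * on_qubit i (depol lam) X x y + d * on_qubit i (depol lam) Y x y)"
  by (auto simp: on_qubit_depol fun_eq_iff algebra_simps add_divide_distrib)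

lemma tensor_power_map_0 [simp]: "tensor_power_map 0 F X = X"
  by (simp add: tensor_power_map_def)

lemma tensor_power_map_Suc [simp]: "tensor_power_map (Suc n) F X = on_qubit n F (tensor_power_map n F X)"
  by (simp add: tensor_power_map_def)

lemma tensor_power_depol_linear:
  "tensor_power_map n (depol lam) (\<lambda>x y. c * X x y + d * Y x y)
     = (\<lambda>x y. c * tensor_power_map n (depol lam) X x y + d * tensor_power_map n (depol lam) Y x y)"
  by (induction n) (simp_all add: on_qubit_depol_linear)

lemma on_qubit_tensor_power_depol_commute:
  "on_qubit i (depol p) (tensor_power_map n (depol q) X) = tensor_power_map n (depol q) (on_qubit i (depol p) X)"
  by (induction n) (simp_all add: on_qubit_depol_commute[of i])

lemma tensor_power_depol_comp:
  "tensor_power_map n (depol (1 - p)) (tensor_power_map n (depol (1 - q)) X)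
     = tensor_power_map n (depol (1 - p * q)) X"
  by (induction n)
    (simp_all add: on_qubit_tensor_power_depol_commute[symmetric] on_qubit_depol_comp mult.commute)

lemma on_qubit_block:
  "i \<noteq> j \<Longrightarrow> on_qubit i F (\<lambda>x y. X (set_bit_of j a x) (set_bit_of j b y))
     = (\<lambda>x y. on_qubit i F X (set_bit_of j a x) (set_bit_of j b y))"
  by (auto simp: on_qubit_def fun_eq_iff set_bit_of_commute[of i j])

text \<open>Noise on the qubits below \<open>n\<close> acts separately on each of the four blocks of
  qubit \<open>j\<close>. This is what allows an induction hypothesis on fewer qubits to be applied
  to blocks.\<close>

lemma tensor_power_map_block:
  "n \<le> j \<Longrightarrow> tensor_power_map n F (\<lambda>x y. X (set_bit_of j a x) (set_bit_of j b y))
     = (\<lambda>x y. tensor_power_map n F X (set_bit_of j a x) (set_bit_of j b y))"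
  by (induction n) (simp_all add: on_qubit_block)

lemma hs_inner_on_qubit_depol:
  assumes "finite S" "i \<in> S"
  shows "hs_inner S X (on_qubit i (depol lam) Y) = hs_inner S (on_qubit i (depol lam) X) Y"
  unfolding hs_inner_eq sum_Pow_bit[OF assms]
  by (simp add: on_qubit_depol sum.distrib[symmetric] algebra_simps add_divide_distrib)

lemma hs_inner_tensor_power_depol:
  assumes "finite S" "{..<n} \<subseteq> S"
  shows "hs_inner S X (tensor_power_map n (depol lam) Y) = hs_inner S (tensor_power_map n (depol lam) X) Y"
  using assms(2)
proof (induction n arbitrary: X)
  case (Suc n)
  then have "n \<in> S" "{..<n} \<subseteq> S" by auto
  then show ?case
    using Suc.IH[of "on_qubit n (depol lam) X"]
    by (simp add: hs_inner_on_qubit_depol[OF assms(1)] on_qubit_tensor_power_depol_commute[of n lam n lam X])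
qed simp

lemma op_tr_on_qubit_depol:
  assumes "finite S" "i \<in> S"
  shows "op_tr S (on_qubit i (depol lam) X) = op_tr S X"
  unfolding op_tr_def sum_Pow_bit[OF assms]
  by (intro sum.cong) (simp_all add: on_qubit_depol algebra_simps add_divide_distrib)

lemma op_tr_tensor_power_depol:
  assumes "finite S" "{..<n} \<subseteq> S"
  shows "op_tr S (tensor_power_map n (depol lam) X) = op_tr S X"
  using assms(2) by (induction n) (auto simp: op_tr_on_qubit_depol[OF assms(1)] lessThan_Suc)

lemma op_adj_tensor_power_depol:
  "op_adj (tensor_power_map n (depol lam) X) = tensor_power_map n (depol lam) (op_adj X)"
proof (induction n)
  case (Suc n)
  have "op_adj (on_qubit i (depol lam) X) = on_qubit i (depol lam) (op_adj X)" for i X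
    by (auto simp: on_qubit_depol op_adj_def fun_eq_iff)
  with Suc show ?case by simp
qed simp

section \<open>Positivity and the variance inequality\<close>

definition op_psd :: "nat set \<Rightarrow> qop \<Rightarrow> bool" where
  "op_psd S X \<longleftrightarrow> (\<forall>v. 0 \<le> Re (\<Sum>x\<in>Pow S. \<Sum>y\<in>Pow S. cnj (v x) * X x y * v y))"

text \<open>The quadratic form of the conjugated operator at \<open>v\<close> is that of
  \<open>X\<close> at \<open>w\<close>, the adjoint of \<open>U\<close> applied to
  \<open>v\<close>.\<close>

lemma op_psd_conj:
  assumes "op_psd S X"
  shows "op_psd S (op_mult S (op_mult S U X) (op_adj U))"
  unfolding op_psd_def
proof
  fix v :: "nat set \<Rightarrow> complex"
  define w where "w z = (\<Sum>x\<in>Pow S. cnj (U x z) * v x)" for z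
  have "(\<Sum>x\<in>Pow S. \<Sum>y\<in>Pow S. cnj (v x) * op_mult S (op_mult S U X) (op_adj U) x y * v y)
      = (\<Sum>x\<in>Pow S. \<Sum>y\<in>Pow S. \<Sum>z\<in>Pow S. \<Sum>t\<in>Pow S. cnj (v x) * U x t * X t z * cnj (U y z) * v y)"
    by (simp add: op_mult_def op_adj_def sum_distrib_left sum_distrib_right mult.assoc)
  also have "\<dots> = (\<Sum>z\<in>Pow S. \<Sum>t\<in>Pow S. \<Sum>x\<in>Pow S. \<Sum>y\<in>Pow S. cnj (v x) * U x t * X t z * cnj (U y z) * v y)"
    unfolding sum.cartesian_product
    by (rule sum.reindex_bij_witness[of _ "\<lambda>(z, t, x, y). (x, y, z, t)" "\<lambda>(x, y, z, t). (z, t, x, y)"]) auto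
  also have "\<dots> = (\<Sum>z\<in>Pow S. \<Sum>t\<in>Pow S. cnj (w t) * X t z * w z)"
    by (simp add: w_def sum_distrib_left sum_distrib_right mult_ac)
  also have "\<dots> = (\<Sum>x\<in>Pow S. \<Sum>y\<in>Pow S. cnj (w x) * X x y * w y)"
    by (rule sum.swap)
  finally show "0 \<le> Re (\<Sum>x\<in>Pow S. \<Sum>y\<in>Pow S. cnj (v x) * op_mult S (op_mult S U X) (op_adj U) x y * v y)"
    using assms by (simp add: op_psd_def)
qed

lemma op_psd_on_qubit_depol:
  assumes "finite S" "i \<in> S" "op_psd S X" "0 \<le> lam" "lam \<le> 1"
  shows "op_psd S (on_qubit i (depol lam) X)"
  unfolding op_psd_def
proof
  fix v :: "nat set \<Rightarrow> complex"
  define q where "q u = (\<Sum>x\<in>Pow S. \<Sum>y\<in>Pow S. cnj (u x) * X x y * u y)" for u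
  \<comment> \<open>\<open>w b c\<close> is the matrix unit |c><b| on qubit \<open>i\<close> applied
    to \<open>v\<close>. Up to the factor 1/sqrt 2 the four matrix units are the Kraus operators of
    complete depolarization, which exhibits the form as a nonnegative combination of forms of
    \<open>X\<close>.\<close>
  define w where "w b c z = (if (i \<in> z) = c then v (set_bit_of i b z) else 0)" for b c z
  have "(\<Sum>x\<in>Pow S. \<Sum>y\<in>Pow S. cnj (v x) * on_qubit i (depol lam) X x y * v y)
     = of_real (1 - lam) * q v + of_real (lam / 2) *
        (q (w False False) + q (w False True) + q (w True False) + q (w True True))"
    unfolding q_def sum_Pow_bit[OF assms(1,2)] w_def
    by (simp add: on_qubit_depol sum.distrib[symmetric] sum_distrib_left algebra_simps add_divide_distrib)
  moreover have "0 \<le> Re (q u)" for u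
    using assms(3) by (simp add: op_psd_def q_def)
  ultimately show "0 \<le> Re (\<Sum>x\<in>Pow S. \<Sum>y\<in>Pow S. cnj (v x) * on_qubit i (depol lam) X x y * v y)"
    using assms(4,5) by (simp add: add_nonneg_nonneg)
qed

lemma op_psd_tensor_power_depol:
  assumes "finite S" "{..<n} \<subseteq> S" "op_psd S X" "0 \<le> lam" "lam \<le> 1"
  shows "op_psd S (tensor_power_map n (depol lam) X)"
  using assms(2) by (induction n) (auto simp: assms op_psd_on_qubit_depol lessThan_Suc)

text \<open>The Cauchy-Schwarz inequality in the state \<open>X\<close>: the variance of \<open>Y\<close> is nonnegative.\<close>

lemma op_psd_variance:
  assumes "finite S" "op_psd S X" "op_tr S X = 1" "op_adj Y = Y"
  shows "(Re (op_tr S (op_mult S X Y)))\<^sup>2 \<le> Re (op_tr S (op_mult S X (op_mult S Y Y)))"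
proof -
  define t where "t = Re (op_tr S (op_mult S X Y))"
  have Y: "cnj (Y x y) = Y y x" for x y
    using assms(4) by (metis op_adj_def)
  define Z where "Z = (\<lambda>x y. Y x y - of_real t * id_op x y)"
  have Z: "cnj (Z x y) = Z y x" for x y
    by (auto simp: Z_def Y id_op_def)
  \<comment> \<open>The columns of \<open>Z\<close> serve as test vectors. Summed over the columns,
    the quadratic forms of \<open>X\<close> give tr Z X Z = tr X Z^2, the variance of
    \<open>Y\<close>.\<close>
  have nonneg: "0 \<le> Re (\<Sum>x\<in>Pow S. \<Sum>y\<in>Pow S. cnj (Z x w) * X x y * Z y w)" for w
    using assms(2)[unfolded op_psd_def, THEN spec, of "\<lambda>x. Z x w"] .
  have "0 \<le> (\<Sum>w\<in>Pow S. Re (\<Sum>x\<in>Pow S. \<Sum>y\<in>Pow S. cnj (Z x w) * X x y * Z y w))"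
    by (intro sum_nonneg nonneg)
  also have "\<dots> = Re (\<Sum>w\<in>Pow S. \<Sum>x\<in>Pow S. \<Sum>y\<in>Pow S. Z w x * X x y * Z y w)"
    by (simp only: Z Re_sum)
  also have "(\<Sum>w\<in>Pow S. \<Sum>x\<in>Pow S. \<Sum>y\<in>Pow S. Z w x * X x y * Z y w)
      = op_tr S (op_mult S Z (op_mult S X Z))"
    by (simp add: op_tr_def op_mult_def sum_distrib_left mult.assoc)
  also have "\<dots> = op_tr S (op_mult S X (op_mult S Z Z))"
    by (subst op_tr_mult_commute) (simp add: op_mult_assoc)
  also have "\<dots> = op_tr S (\<lambda>x y. op_mult S X (op_mult S Y Y) x y
      - (of_real (2 * t) * op_mult S X Y x y - of_real (t\<^sup>2) * X x y))"
  proof (rule op_tr_cong)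
    have "op_mult S Z Z = (\<lambda>x y. op_mult S Y Y x y - of_real t * op_mult S Y id_op x y
        - (of_real t * op_mult S id_op Y x y - of_real t * (of_real t * op_mult S id_op id_op x y)))"
      unfolding Z_def op_mult_diff_left op_mult_diff_right op_mult_scale_left op_mult_scale_right
      by (simp add: right_diff_distrib)
    moreover have "op_mult S Y id_op x y = Y x y" "op_mult S id_op Y x y = Y x y" "op_mult S id_op id_op x y = id_op x y"
      if "x \<in> Pow S" "y \<in> Pow S" for x y
      using that op_mult_id_left[OF assms(1)] op_mult_id_right[OF assms(1)] by (auto simp: op_eq_def)
    ultimately have "op_mult S Z Z x y = op_mult S Y Y x y - (of_real (2 * t) * Y x y - of_real (t\<^sup>2) * id_op x y)"
      if "x \<in> Pow S" "y \<in> Pow S" for x y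
      using that by (simp add: power2_eq_square)
    then have "op_eq S (op_mult S Z Z) (\<lambda>x y. op_mult S Y Y x y - (of_real (2 * t) * Y x y - of_real (t\<^sup>2) * id_op x y))"
      by (simp add: op_eq_def)
    then have "op_eq S (op_mult S X (op_mult S Z Z))
        (op_mult S X (\<lambda>x y. op_mult S Y Y x y - (of_real (2 * t) * Y x y - of_real (t\<^sup>2) * id_op x y)))"
      by (intro op_mult_cong op_eq_refl)
    also have "op_mult S X (\<lambda>x y. op_mult S Y Y x y - (of_real (2 * t) * Y x y - of_real (t\<^sup>2) * id_op x y))
      = (\<lambda>x y. op_mult S X (op_mult S Y Y) x y - (of_real (2 * t) * op_mult S X Y x y - of_real (t\<^sup>2) * op_mult S X id_op x y))"
      by (simp only: op_mult_diff_right op_mult_scale_right)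
    finally show "op_eq S (op_mult S X (op_mult S Z Z)) (\<lambda>x y. op_mult S X (op_mult S Y Y) x y
      - (of_real (2 * t) * op_mult S X Y x y - of_real (t\<^sup>2) * X x y))"
      using op_mult_id_right[OF assms(1), of X] by (simp add: op_eq_def)
  qed
  also have "\<dots> = op_tr S (op_mult S X (op_mult S Y Y)) - (of_real (2 * t) * op_tr S (op_mult S X Y) - of_real (t\<^sup>2))"
    using assms(3) by (simp add: op_tr_def sum_subtractf sum_distrib_left[symmetric])
  finally show ?thesis
    by (simp add: t_def power2_eq_square)
qed

section \<open>Hypercontractivity\<close>

definition op_block :: "nat \<Rightarrow> bool \<Rightarrow> bool \<Rightarrow> qop \<Rightarrow> qop" where
  "op_block i a b X = (\<lambda>x y. X (set_bit_of i a x) (set_bit_of i b y))"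

lemma op_mult_block:
  assumes "finite S" "i \<in> S"
  shows "op_block i a b (op_mult S X Y) =
    (\<lambda>x y. op_mult (S - {i}) (op_block i a False X) (op_block i False b Y) x y
         + op_mult (S - {i}) (op_block i a True X) (op_block i True b Y) x y)"
  by (simp add: op_block_def op_mult_def sum_Pow_bit[OF assms] sum.distrib)

lemma op_adj_block: "op_block i a b (op_adj X) = op_adj (op_block i b a X)"
  by (simp add: op_block_def op_adj_def)

lemma hs_norm_block:
  assumes "finite S" "i \<in> S"
  shows "(hs_norm S X)\<^sup>2 =
      (hs_norm (S - {i}) (op_block i False False X))\<^sup>2 + (hs_norm (S - {i}) (op_block i True True X))\<^sup>2
    + (hs_norm (S - {i}) (op_block i False True X))\<^sup>2 + (hs_norm (S - {i}) (op_block i True False X))\<^sup>2"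
  by (simp add: op_block_def hs_norm_square sum_Pow_bit[OF assms] sum.distrib)

text \<open>For the two diagonal blocks of a qubit, the half sum and the half difference are the
  components along the Pauli matrices I and Z. The identity rewrites the squared norm in terms of
  the components that noise scales by different factors.\<close>

lemma hs_norm_parallelogram:
  "(hs_norm S X)\<^sup>2 + (hs_norm S Y)\<^sup>2
     = 2 * (hs_norm S (\<lambda>x y. (1 / 2) * X x y + (1 / 2) * Y x y))\<^sup>2
     + 2 * (hs_norm S (\<lambda>x y. (1 / 2) * X x y + (- 1 / 2) * Y x y))\<^sup>2"
proof -
  have "(cmod u)\<^sup>2 + (cmod v)\<^sup>2 = 2 * (cmod ((1 / 2) * u + (1 / 2) * v))\<^sup>2 + 2 * (cmod ((1 / 2) * u + (- 1 / 2) * v))\<^sup>2"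
    for u v
    unfolding cmod_power2 by (simp add: power2_eq_square field_simps)
  then show ?thesis
    by (simp only: hs_norm_square sum.distrib[symmetric] sum_distrib_left)
qed

text \<open>\<open>a\<close>, \<open>d\<close>, \<open>e\<close>, \<open>g\<close> are the Schatten
  4-norms of the four components in \<open>hypercontractive_step\<close>. The right side involves
  only \<open>a\<^sup>2\<close> and \<open>s\<close>, the combinations that the induction hypothesis
  controls. The coefficient 2 of the leading term has to be exact, because it is matched against a
  square in \<open>hypercontractive\<close>; the others may be crude, since a small \<open>r\<close>
  pays for them. They add up from the four estimates in the proof as 16 = 2 + 4 + 2 + 8 and 6 = 1 +
  1 + 4.\<close>

lemma hypercontractive_numeric:
  fixes a d e g r :: real
  assumes "0 \<le> a" "0 \<le> d" "0 \<le> e" "0 \<le> g" "0 \<le> r"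
  defines "s \<equiv> 2 * d\<^sup>2 + e\<^sup>2 + g\<^sup>2"
  shows "(a\<^sup>2 + r\<^sup>2 * (d\<^sup>2 + g\<^sup>2))\<^sup>2 + (a\<^sup>2 + r\<^sup>2 * (d\<^sup>2 + e\<^sup>2))\<^sup>2
      + 2 * (2 * r * (a * d))\<^sup>2 + 2 * (2 * r * (a * d) * (r\<^sup>2 * (g\<^sup>2 + e\<^sup>2)))
      + 2 * (r * (a * (e + g)) + r\<^sup>2 * (d * (e + g)))\<^sup>2
     \<le> 2 * (a\<^sup>2)\<^sup>2 + 16 * r\<^sup>2 * (a\<^sup>2 * s) + 6 * r ^ 4 * s\<^sup>2"
proof -
  have s: "0 \<le> s" "d\<^sup>2 \<le> s / 2" "e\<^sup>2 + g\<^sup>2 \<le> s" by (simp_all add: s_def)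
  have 0: "a\<^sup>2 + r\<^sup>2 * d\<^sup>2 \<le> a\<^sup>2 + r\<^sup>2 * (s / 2)"
    by (intro add_left_mono mult_left_mono s) auto
  have "(d\<^sup>2 + g\<^sup>2)\<^sup>2 + (d\<^sup>2 + e\<^sup>2)\<^sup>2 \<le> ((d\<^sup>2 + g\<^sup>2) + (d\<^sup>2 + e\<^sup>2))\<^sup>2"
    unfolding power2_sum[of "d\<^sup>2 + g\<^sup>2"] by simp
  also have "\<dots> = s\<^sup>2" by (simp add: s_def algebra_simps)
  finally have "r ^ 4 * ((d\<^sup>2 + g\<^sup>2)\<^sup>2 + (d\<^sup>2 + e\<^sup>2)\<^sup>2) \<le> r ^ 4 * s\<^sup>2"
    by (intro mult_left_mono) auto
  moreover have "(a\<^sup>2 + r\<^sup>2 * (d\<^sup>2 + g\<^sup>2))\<^sup>2 + (a\<^sup>2 + r\<^sup>2 * (d\<^sup>2 + e\<^sup>2))\<^sup>2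
      = 2 * (a\<^sup>2)\<^sup>2 + 2 * r\<^sup>2 * (a\<^sup>2 * s) + r ^ 4 * ((d\<^sup>2 + g\<^sup>2)\<^sup>2 + (d\<^sup>2 + e\<^sup>2)\<^sup>2)"
    unfolding s_def by algebra
  ultimately have 1: "(a\<^sup>2 + r\<^sup>2 * (d\<^sup>2 + g\<^sup>2))\<^sup>2 + (a\<^sup>2 + r\<^sup>2 * (d\<^sup>2 + e\<^sup>2))\<^sup>2
      \<le> 2 * (a\<^sup>2)\<^sup>2 + 2 * r\<^sup>2 * (a\<^sup>2 * s) + r ^ 4 * s\<^sup>2"
    by simp
  have "2 * (2 * r * (a * d))\<^sup>2 = 8 * r\<^sup>2 * a\<^sup>2 * d\<^sup>2" by algebra
  also have "\<dots> \<le> 8 * r\<^sup>2 * a\<^sup>2 * (s / 2)" by (intro mult_left_mono s) auto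
  finally have 2: "2 * (2 * r * (a * d))\<^sup>2 \<le> 4 * r\<^sup>2 * (a\<^sup>2 * s)" by simp
  have "2 * (2 * r * (a * d) * (r\<^sup>2 * (g\<^sup>2 + e\<^sup>2))) \<le> 2 * (2 * r * (a * d) * (r\<^sup>2 * s))"
    using assms s by (intro mult_left_mono) auto
  also have "\<dots> = 2 * r\<^sup>2 * s * (2 * a * (r * d))" by algebra
  also have "\<dots> \<le> 2 * r\<^sup>2 * s * (a\<^sup>2 + (r * d)\<^sup>2)"
    using s sum_squares_bound[of a "r * d"] by (intro mult_left_mono) auto
  also have "\<dots> \<le> 2 * r\<^sup>2 * s * (a\<^sup>2 + r\<^sup>2 * (s / 2))"
    using s 0 by (intro mult_left_mono) (auto simp: power_mult_distrib)
  also have "\<dots> = 2 * r\<^sup>2 * (a\<^sup>2 * s) + r ^ 4 * s\<^sup>2"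
    by (simp add: algebra_simps power2_eq_square power4_eq_xxxx)
  finally have 3: "2 * (2 * r * (a * d) * (r\<^sup>2 * (g\<^sup>2 + e\<^sup>2))) \<le> 2 * r\<^sup>2 * (a\<^sup>2 * s) + r ^ 4 * s\<^sup>2" .
  have "2 * (r * (a * (e + g)) + r\<^sup>2 * (d * (e + g)))\<^sup>2 = 2 * r\<^sup>2 * ((e + g)\<^sup>2 * (a + r * d)\<^sup>2)"
    by algebra
  also have "\<dots> \<le> 2 * r\<^sup>2 * ((2 * s) * (2 * (a\<^sup>2 + r\<^sup>2 * (s / 2))))"
  proof (intro mult_left_mono mult_mono)
    show "(e + g)\<^sup>2 \<le> 2 * s"
      using s(3) sum_squares_bound[of e g] by (simp add: power2_sum)
    show "(a + r * d)\<^sup>2 \<le> 2 * (a\<^sup>2 + r\<^sup>2 * (s / 2))"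
      using 0 sum_squares_bound[of a "r * d"] by (simp add: power2_sum power_mult_distrib)
  qed (use s in auto)
  also have "\<dots> = 8 * r\<^sup>2 * (a\<^sup>2 * s) + 4 * r ^ 4 * s\<^sup>2"
    by (simp add: algebra_simps power2_eq_square power4_eq_xxxx)
  finally have 4: "2 * (r * (a * (e + g)) + r\<^sup>2 * (d * (e + g)))\<^sup>2 \<le> 8 * r\<^sup>2 * (a\<^sup>2 * s) + 4 * r ^ 4 * s\<^sup>2" .
  from 1 2 3 4 show ?thesis by linarith
qed

text \<open>After noise on qubit \<open>i\<close> the identity component \<open>A\<close> is
  unchanged and all others carry a factor \<open>r\<close>. The diagonal blocks of the Gram operator
  of \<open>Y\<close> contain a term \<open>V\<close> of first order in \<open>r\<close>, with
  opposite signs, and \<open>hs_norm_pair_le\<close> lets it interact only with a difference of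
  order r^2. The off-diagonal blocks are themselves of order \<open>r\<close> and enter
  squared.\<close>

lemma hypercontractive_step:
  fixes A D E G Y :: qop and r :: real
  assumes S: "finite S" "i \<in> S" and r: "0 \<le> r"
    and Yff: "op_block i False False Y = (\<lambda>x y. A x y + of_real r * D x y)"
    and Ytt: "op_block i True True Y = (\<lambda>x y. A x y - of_real r * D x y)"
    and Yft: "op_block i False True Y = (\<lambda>x y. of_real r * E x y)"
    and Ytf: "op_block i True False Y = (\<lambda>x y. of_real r * G x y)"
  defines "p \<equiv> \<lambda>X. hs_norm (S - {i}) (op_mult (S - {i}) (op_adj X) X)"
  shows "(hs_norm S (op_mult S (op_adj Y) Y))\<^sup>2
    \<le> 2 * (p A)\<^sup>2 + 16 * r\<^sup>2 * (p A * (2 * p D + p E + p G)) + 6 * r ^ 4 * (2 * p D + p E + p G)\<^sup>2"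
proof -
  let ?S = "S - {i}"
  let ?N = "hs_norm ?S"
  define M :: "qop \<Rightarrow> qop \<Rightarrow> qop" where "M X Z = op_mult ?S (op_adj X) Z" for X Z
  \<comment> \<open>\<open>q X\<close> is the Schatten 4-norm of \<open>X\<close>, and
    \<open>MN\<close> below is Hoelder's inequality for it.\<close>
  define q where "q X = sqrt (p X)" for X
  have q: "0 \<le> q X" "(q X)\<^sup>2 = p X" "?N (M X X) = (q X)\<^sup>2" for X
    by (simp_all add: q_def p_def M_def)
  have MN: "?N (M X Z) \<le> q X * q Z" for X Z
  proof -
    have "(?N (M X Z))\<^sup>2 \<le> (q X * q Z)\<^sup>2"
      unfolding M_def power_mult_distrib q(2) p_def by (rule hs_norm_adj_mult_le)
    then show ?thesis by (rule power2_le_imp_le) (simp add: q(1))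
  qed
  have adj_simps: "op_adj (\<lambda>x y. X x y + Z x y) = (\<lambda>x y. op_adj X x y + op_adj Z x y)"
    "op_adj (\<lambda>x y. X x y - Z x y) = (\<lambda>x y. op_adj X x y - op_adj Z x y)"
    "op_adj (\<lambda>x y. of_real r * X x y) = (\<lambda>x y. of_real r * op_adj X x y)" for X Z
    by (simp_all add: op_adj_def)
  note expand = op_mult_block[OF S] op_adj_block Yff Ytt Yft Ytf adj_simps
    op_mult_add_left op_mult_add_right op_mult_diff_left op_mult_diff_right
    op_mult_scale_left op_mult_scale_right M_def
  define P where "P = op_mult S (op_adj Y) Y"
  define U :: qop where "U = (\<lambda>x y. M A A x y + of_real (r\<^sup>2) * (M D D x y + M G G x y))"
  define W :: qop where "W = (\<lambda>x y. M A A x y + of_real (r\<^sup>2) * (M D D x y + M E E x y))"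
  define V :: qop where "V = (\<lambda>x y. of_real r * (M A D x y + M D A x y))"
  have ff: "op_block i False False P = (\<lambda>x y. U x y + V x y)"
    unfolding P_def U_def V_def expand by (simp add: fun_eq_iff algebra_simps power2_eq_square)
  have tt: "op_block i True True P = (\<lambda>x y. W x y - V x y)"
    unfolding P_def W_def V_def expand by (simp add: fun_eq_iff algebra_simps power2_eq_square)
  have ft: "op_block i False True P = (\<lambda>x y. of_real r * (M A E x y + M G A x y) + of_real (r\<^sup>2) * (M D E x y - M G D x y))"
    unfolding P_def expand by (simp add: fun_eq_iff algebra_simps power2_eq_square)
  have tf: "op_block i True False P = op_adj (op_block i False True P)"
    by (metis P_def op_adj_adj op_adj_block op_adj_mult)
  have add_le: "?N (\<lambda>x y. X x y + Z x y) \<le> u + v" if "?N X \<le> u" "?N Z \<le> v" for X Z u v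
    using hs_norm_triangle[of ?S X Z] that by linarith
  have diff_le: "?N (\<lambda>x y. X x y - Z x y) \<le> u + v" if "?N X \<le> u" "?N Z \<le> v" for X Z u v
    using hs_norm_triangle_diff[of ?S X Z] that by linarith
  have scale_le: "?N (\<lambda>x y. of_real c * X x y) \<le> c * u" if "?N X \<le> u" "0 \<le> c" for X c u
    using that by (simp add: hs_norm_scale mult_left_mono)
  have NU: "?N U \<le> (q A)\<^sup>2 + r\<^sup>2 * ((q D)\<^sup>2 + (q G)\<^sup>2)"
    unfolding U_def by (intro add_le scale_le) (simp_all add: q)
  have NW: "?N W \<le> (q A)\<^sup>2 + r\<^sup>2 * ((q D)\<^sup>2 + (q E)\<^sup>2)"
    unfolding W_def by (intro add_le scale_le) (simp_all add: q)
  have "?N V \<le> r * (q A * q D + q D * q A)"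
    unfolding V_def by (intro add_le scale_le MN r)
  then have NV: "?N V \<le> 2 * r * (q A * q D)" by (simp add: algebra_simps)
  \<comment> \<open>The terms \<open>M A A\<close> and \<open>M D D\<close> cancel, so the cross
    term with \<open>V\<close> is of order r^3 and not of order \<open>r\<close>.\<close>
  have UW: "(\<lambda>x y. U x y - W x y) = (\<lambda>x y. of_real (r\<^sup>2) * (M G G x y - M E E x y))"
    by (simp add: U_def W_def algebra_simps)
  have NUW: "?N (\<lambda>x y. U x y - W x y) \<le> r\<^sup>2 * ((q G)\<^sup>2 + (q E)\<^sup>2)"
    unfolding UW by (intro diff_le scale_le) (simp_all add: q)
  have "?N (op_block i False True P) \<le> r * (q A * q E + q G * q A) + r\<^sup>2 * (q D * q E + q G * q D)"
    unfolding ft by (intro add_le diff_le scale_le MN r) simp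
  then have Nft: "?N (op_block i False True P) \<le> r * (q A * (q E + q G)) + r\<^sup>2 * (q D * (q E + q G))"
    by (simp add: algebra_simps)
  have "(hs_norm S P)\<^sup>2 = (?N (\<lambda>x y. U x y + V x y))\<^sup>2 + (?N (\<lambda>x y. W x y - V x y))\<^sup>2
      + 2 * (?N (op_block i False True P))\<^sup>2"
    unfolding hs_norm_block[OF S] ff tt tf by simp
  also have "\<dots> \<le> ((?N U)\<^sup>2 + (?N W)\<^sup>2 + 2 * (?N V)\<^sup>2 + 2 * (?N V * ?N (\<lambda>x y. U x y - W x y)))
      + 2 * (?N (op_block i False True P))\<^sup>2"
    by (intro add_right_mono hs_norm_pair_le)
  also have "\<dots> \<le> (((q A)\<^sup>2 + r\<^sup>2 * ((q D)\<^sup>2 + (q G)\<^sup>2))\<^sup>2 + ((q A)\<^sup>2 + r\<^sup>2 * ((q D)\<^sup>2 + (q E)\<^sup>2))\<^sup>2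
      + 2 * (2 * r * (q A * q D))\<^sup>2 + 2 * (2 * r * (q A * q D) * (r\<^sup>2 * ((q G)\<^sup>2 + (q E)\<^sup>2))))
      + 2 * (r * (q A * (q E + q G)) + r\<^sup>2 * (q D * (q E + q G)))\<^sup>2"
    by (intro add_mono mult_left_mono power_mono mult_mono NU NW NV NUW Nft) (use r q(1) in auto)
  also have "\<dots> \<le> 2 * ((q A)\<^sup>2)\<^sup>2 + 16 * r\<^sup>2 * ((q A)\<^sup>2 * (2 * (q D)\<^sup>2 + (q E)\<^sup>2 + (q G)\<^sup>2))
      + 6 * r ^ 4 * (2 * (q D)\<^sup>2 + (q E)\<^sup>2 + (q G)\<^sup>2)\<^sup>2"
    by (intro hypercontractive_numeric q r)
  finally show ?thesis unfolding q(2) P_def .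
qed

text \<open>The quantum analogue of the Bonami inequality \<open>\<parallel>T\<^sub>r X\<parallel>\<^sub>4 \<le> \<parallel>X\<parallel>\<^sub>2\<close> (norms with respect to the normalized
  trace), where \<open>\<parallel>Y\<parallel>\<^sub>4\<close> is the square root of the norm of \<open>Y\<^sup>* Y\<close>.\<close>

theorem hypercontractive:
  fixes r :: real
  assumes "0 \<le> r" "r\<^sup>2 \<le> 1 / 8"
  defines "T \<equiv> \<lambda>n. tensor_power_map n (depol (1 - r))"
  shows "sqrt (2 ^ n) * hs_norm {..<n} (op_mult {..<n} (op_adj (T n X)) (T n X)) \<le> (hs_norm {..<n} X)\<^sup>2"
proof (induction n arbitrary: X)
  case 0
  have "{..<0::nat} = {}" by auto
  then show ?case
    by (simp add: hs_norm_eq_L2_set T_def op_mult_def op_adj_def norm_mult power2_eq_square)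
next
  case (Suc n)
  let ?S = "{..<Suc n}" and ?m = "sqrt (2 ^ n) :: real"
  have S: "finite ?S" "n \<in> ?S" and S': "?S - {n} = {..<n}"
    by auto
  define B where "B a b = op_block n a b X" for a b
  \<comment> \<open>\<open>X0\<close> and \<open>X1\<close> are the components of \<open>X\<close>
    along I and Z on the last qubit. Noise on that qubit keeps \<open>X0\<close> and multiplies
    \<open>X1\<close> and the two off-diagonal blocks by \<open>r\<close>, which is the shape
    required by \<open>hypercontractive_step\<close>.\<close>
  define X0 :: qop where "X0 = (\<lambda>x y. (1 / 2) * B False False x y + (1 / 2) * B True True x y)"
  define X1 :: qop where "X1 = (\<lambda>x y. (1 / 2) * B False False x y + (- 1 / 2) * B True True x y)"
  have TB: "op_block n a b (T n X) = T n (B a b)" for a b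
    by (simp add: T_def B_def op_block_def tensor_power_map_block)
  have TX0: "T n X0 = (\<lambda>x y. (1 / 2) * T n (B False False) x y + (1 / 2) * T n (B True True) x y)"
    unfolding T_def X0_def by (rule tensor_power_depol_linear)
  have TX1: "T n X1 = (\<lambda>x y. (1 / 2) * T n (B False False) x y + (- 1 / 2) * T n (B True True) x y)"
    unfolding T_def X1_def by (rule tensor_power_depol_linear)
  have TS: "T (Suc n) X = on_qubit n (depol (1 - r)) (T n X)"
    by (simp add: T_def)
  have TBx: "T n X (set_bit_of n a x) (set_bit_of n b y) = T n (B a b) x y" for a b x y
    by (simp add: TB[symmetric] op_block_def)
  define p where "p Y = hs_norm (?S - {n}) (op_mult (?S - {n}) (op_adj Y) Y)" for Y
  define s where "s = 2 * p (T n X1) + p (T n (B False True)) + p (T n (B True False))"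
  have step: "(hs_norm ?S (op_mult ?S (op_adj (T (Suc n) X)) (T (Suc n) X)))\<^sup>2
      \<le> 2 * (p (T n X0))\<^sup>2 + 16 * r\<^sup>2 * (p (T n X0) * s) + 6 * r ^ 4 * s\<^sup>2"
    unfolding p_def s_def
    by (rule hypercontractive_step[OF S assms(1)])
      (auto simp: op_block_def TS on_qubit_depol TBx TX0 TX1 fun_eq_iff field_simps)
  define \<alpha> where "\<alpha> = (hs_norm {..<n} X0)\<^sup>2"
  define \<beta> where "\<beta> = 2 * (hs_norm {..<n} X1)\<^sup>2 + (hs_norm {..<n} (B False True))\<^sup>2 + (hs_norm {..<n} (B True False))\<^sup>2"
  have N: "(hs_norm ?S X)\<^sup>2 = 2 * \<alpha> + \<beta>"
    unfolding hs_norm_block[OF S] S' B_def[symmetric] \<alpha>_def \<beta>_def X0_def X1_def hs_norm_parallelogram by simp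
  have nonneg: "0 \<le> p Y" "0 \<le> s" "0 \<le> \<alpha>" "0 \<le> \<beta>" for Y
    by (simp_all add: p_def s_def \<alpha>_def \<beta>_def)
  have pX0: "?m * p (T n X0) \<le> \<alpha>"
    using Suc[of X0] by (simp add: p_def S' \<alpha>_def)
  have ps: "?m * s \<le> \<beta>"
    using Suc[of X1] Suc[of "B False True"] Suc[of "B True False"]
    by (simp add: p_def S' s_def \<beta>_def algebra_simps)
  let ?h = "hs_norm ?S (op_mult ?S (op_adj (T (Suc n) X)) (T (Suc n) X))"
  have "(sqrt (2 ^ Suc n) * ?h)\<^sup>2 = 2 * (?m\<^sup>2 * ?h\<^sup>2)"
    by (simp add: power_mult_distrib)
  also have "\<dots> \<le> 2 * (?m\<^sup>2 * (2 * (p (T n X0))\<^sup>2 + 16 * r\<^sup>2 * (p (T n X0) * s) + 6 * r ^ 4 * s\<^sup>2))"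
    using step by (intro mult_left_mono) auto
  also have "\<dots> = 4 * (?m * p (T n X0))\<^sup>2 + 32 * r\<^sup>2 * ((?m * p (T n X0)) * (?m * s)) + 12 * (r\<^sup>2)\<^sup>2 * (?m * s)\<^sup>2"
    by algebra
  \<comment> \<open>This is the origin of 1/8: it turns 32 r^2 into 4, the coefficient of
    \<alpha>\<beta> in (2\<alpha> + \<beta>)^2. The coefficient of \<beta>^2 becomes 12/64 and
    leaves room.\<close>
  also have "\<dots> \<le> 4 * \<alpha>\<^sup>2 + 32 * (1 / 8) * (\<alpha> * \<beta>) + 12 * (1 / 8)\<^sup>2 * \<beta>\<^sup>2"
    using nonneg pX0 ps assms(2) by (intro add_mono mult_left_mono mult_mono power_mono) auto
  also have "\<dots> \<le> (2 * \<alpha> + \<beta>)\<^sup>2"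
    by (simp add: power2_sum power_divide)
  finally have "(sqrt (2 ^ Suc n) * ?h)\<^sup>2 \<le> ((hs_norm ?S X)\<^sup>2)\<^sup>2"
    unfolding N .
  then show ?case by (rule power2_le_imp_le) simp
qed

section \<open>Decay of the purity\<close>

text \<open>Cauchy-Schwarz against the identity. It keeps the purity f at least 1, hence positive as
  the base of the real powers below.\<close>

lemma hs_norm_ge_trace:
  assumes "finite S" "op_tr S X = 1"
  shows "1 \<le> 2 ^ card S * (hs_norm S X)\<^sup>2"
proof -
  have "1 \<le> (hs_norm S id_op * hs_norm S X)"
    using hs_cauchy_schwarz[of S id_op X] op_tr_eq_hs_inner_id[OF assms(1), of X] assms(2) by simp
  then have "1 \<le> (hs_norm S id_op * hs_norm S X)\<^sup>2"
    using one_le_power by blast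
  then show ?thesis
    using assms by (simp add: power_mult_distrib hs_norm_id)
qed

lemma noise_inner_le:
  fixes X :: qop and r :: real and n :: nat
  assumes X: "op_psd {..<n} X" "op_tr {..<n} X = 1" "op_adj X = X"
    and r: "0 \<le> r" "r\<^sup>2 \<le> 1 / 8"
  shows "2 ^ n * Re (hs_inner {..<n} X (tensor_power_map n (depol (1 - r)) X))
    \<le> (2 ^ n * (hs_norm {..<n} X)\<^sup>2) powr (3 / 4)"
proof -
  let ?S = "{..<n}" and ?m = "sqrt (2 ^ n) :: real"
  define Y where "Y = tensor_power_map n (depol (1 - r)) X"
  define t where "t = Re (hs_inner ?S X Y)"
  \<comment> \<open>\<open>u\<^sup>2\<close> is the purity f, so the target (m^2 t)^2 <= u^3, with m
    the square root of 2^n, reads m^2 t <= f^(3/4).\<close>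
  define u where "u = ?m * hs_norm ?S X"
  have Y: "op_adj Y = Y"
    by (simp add: Y_def op_adj_tensor_power_depol X(3))
  have "t\<^sup>2 \<le> Re (op_tr ?S (op_mult ?S X (op_mult ?S Y Y)))"
    using op_psd_variance[OF _ X(1,2) Y] by (simp add: t_def hs_inner_def X(3))
  also have "\<dots> \<le> hs_norm ?S X * hs_norm ?S (op_mult ?S Y Y)"
    using hs_cauchy_schwarz[of ?S X "op_mult ?S Y Y"] complex_Re_le_cmod
    unfolding hs_inner_def X(3) by (rule order_trans[rotated])
  finally have "?m * t\<^sup>2 \<le> ?m * (hs_norm ?S X * hs_norm ?S (op_mult ?S Y Y))"
    by (rule mult_left_mono) simp
  also have "\<dots> = hs_norm ?S X * (?m * hs_norm ?S (op_mult ?S Y Y))" by simp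
  also have "\<dots> \<le> hs_norm ?S X * (hs_norm ?S X)\<^sup>2"
    using hypercontractive[OF r, of n X] by (intro mult_left_mono) (simp_all add: Y_def[symmetric] Y)
  \<comment> \<open>Multiplication by the cube of \<open>?m\<close> normalizes both sides at once:
    m^4 t^2 on the left and u^3 on the right.\<close>
  finally have "?m ^ 3 * (?m * t\<^sup>2) \<le> ?m ^ 3 * (hs_norm ?S X * (hs_norm ?S X)\<^sup>2)"
    by (rule mult_left_mono) simp
  then have "(?m\<^sup>2 * t)\<^sup>2 \<le> u ^ 3"
    unfolding u_def by (simp add: power2_eq_square power3_eq_cube mult_ac)
  moreover have "0 < u"
  proof -
    have "(?m * hs_norm ?S X)\<^sup>2 \<ge> 1"
      using hs_norm_ge_trace[OF _ X(2)] by (simp add: power_mult_distrib)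
    then show ?thesis unfolding u_def
      by (smt (verit) hs_norm_nonneg mult_nonneg_nonneg real_sqrt_ge_zero zero_le_power zero_eq_power2)
  qed
  moreover have "u ^ 3 = ((u\<^sup>2) powr (3 / 4))\<^sup>2"
  proof -
    have "u * u = u powr 2" "u ^ 3 = u powr 3"
      using \<open>0 < u\<close> by (simp_all add: power2_eq_square)
    then show ?thesis by (simp only: powr_powr power2_eq_square powr_add[symmetric]) simp
  qed
  ultimately have "(?m\<^sup>2 * t)\<^sup>2 \<le> ((u\<^sup>2) powr (3 / 4))\<^sup>2" by simp
  then have "?m\<^sup>2 * t \<le> (u\<^sup>2) powr (3 / 4)"
    by (rule power2_le_imp_le) simp
  then show ?thesis
    by (simp add: t_def u_def Y_def power_mult_distrib)
qed

text \<open>Noise is self-adjoint and two applications with factor \<open>q\<close> make one with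
  factor \<open>q\<^sup>2\<close>, so the squared norm of the noisy operator is the inner product of
  \<open>X\<close> with its noisy version at \<open>q\<^sup>2\<close>. For \<open>k = 0\<close> this
  is \<open>noise_inner_le\<close>, which explains \<open>Suc k\<close> in the hypothesis. Each
  further squaring uses Cauchy-Schwarz and averages the exponent with 1, halving its gap to 1, which
  starts from 1/4.\<close>

lemma noise_norm_le:
  fixes X :: qop and q :: real and n :: nat
  assumes X: "op_psd {..<n} X" "op_tr {..<n} X = 1" "op_adj X = X"
    and q: "0 \<le> q" "(q ^ 2 ^ Suc k)\<^sup>2 \<le> 1 / 8"
  shows "2 ^ n * (hs_norm {..<n} (tensor_power_map n (depol (1 - q)) X))\<^sup>2
    \<le> (2 ^ n * (hs_norm {..<n} X)\<^sup>2) powr (1 - (1 / 2) ^ k / 4)"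
  using q
proof (induction k arbitrary: q)
  case (0 q)
  have "(hs_norm {..<n} (tensor_power_map n (depol (1 - q)) X))\<^sup>2
      = Re (hs_inner {..<n} X (tensor_power_map n (depol (1 - q\<^sup>2)) X))" for q
    using hs_inner_tensor_power_depol[of "{..<n}" n X "1 - q" "tensor_power_map n (depol (1 - q)) X"]
      hs_inner_self_norm[of "{..<n}" "tensor_power_map n (depol (1 - q)) X"]
    by (simp add: tensor_power_depol_comp power2_eq_square)
  then show ?case
    using noise_inner_le[OF X, of "q\<^sup>2"] 0 by simp
next
  case (Suc k q)
  let ?S = "{..<n}"
  define f where "f = 2 ^ n * (hs_norm ?S X)\<^sup>2"
  define g where "g q = 2 ^ n * (hs_norm ?S (tensor_power_map n (depol (1 - q)) X))\<^sup>2" for q :: real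
  have f: "1 \<le> f" using hs_norm_ge_trace[OF _ X(2)] by (simp add: f_def)
  have IH: "g (q\<^sup>2) \<le> f powr (1 - (1 / 2) ^ k / 4)"
    unfolding g_def f_def using Suc.prems by (intro Suc.IH) (simp_all add: power_mult[symmetric])
  have "(hs_norm ?S (tensor_power_map n (depol (1 - q)) X))\<^sup>2
      = cmod (hs_inner ?S X (tensor_power_map n (depol (1 - q\<^sup>2)) X))"
    using hs_inner_tensor_power_depol[of ?S n X "1 - q" "tensor_power_map n (depol (1 - q)) X"]
      hs_inner_self_norm[of ?S "tensor_power_map n (depol (1 - q)) X"]
    by (simp add: tensor_power_depol_comp power2_eq_square norm_mult)
  also have "\<dots> \<le> hs_norm ?S X * hs_norm ?S (tensor_power_map n (depol (1 - q\<^sup>2)) X)"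
    by (rule hs_cauchy_schwarz)
  finally have "g q \<le> 2 ^ n * (hs_norm ?S X * hs_norm ?S (tensor_power_map n (depol (1 - q\<^sup>2)) X))"
    unfolding g_def by (rule mult_left_mono) simp
  also have "\<dots> = sqrt f * sqrt (g (q\<^sup>2))"
    by (simp add: f_def g_def real_sqrt_mult)
  also have "\<dots> \<le> sqrt f * sqrt (f powr (1 - (1 / 2) ^ k / 4))"
    using IH f by (intro mult_left_mono) auto
  also have "\<dots> = f powr (1 - (1 / 2) ^ Suc k / 4)"
    using f by (simp add: powr_half_sqrt[symmetric] powr_powr powr_add[symmetric] field_simps)
  finally show ?case by (simp add: f_def g_def)
qed

section \<open>Layers as isometries and the purity of the noisy state\<close>

lemma gate_op_isometry:
  assumes "finite S" "fst g \<subseteq> S" "op_unitary (fst g) (snd g)"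
  shows "op_eq S (op_mult S (op_adj (gate_op g)) (gate_op g)) id_op"
proof -
  have "op_eq S (op_tensor (fst g) (op_mult (fst g) (op_adj (snd g)) (snd g)) (op_mult (S - fst g) id_op id_op))
      (op_tensor (fst g) id_op id_op)"
    using assms(2,3) op_mult_id_left[of "S - fst g" id_op] assms(1)
    by (auto simp: op_eq_def op_unitary_def op_tensor_def subset_iff)
  then show ?thesis
    unfolding gate_op_def op_adj_tensor op_tensor_mult[OF assms(1,2)] op_adj_id by (simp only: op_tensor_id)
qed

lemma op_mult_isometry:
  assumes "finite S" "op_eq S (op_mult S (op_adj U) U) id_op" "op_eq S (op_mult S (op_adj V) V) id_op"
  shows "op_eq S (op_mult S (op_adj (op_mult S U V)) (op_mult S U V)) id_op"
proof -
  have "op_mult S (op_adj (op_mult S U V)) (op_mult S U V) = op_mult S (op_adj V) (op_mult S (op_mult S (op_adj U) U) V)"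
    by (simp add: op_adj_mult op_mult_assoc)
  moreover have "op_eq S (op_mult S (op_adj V) (op_mult S (op_mult S (op_adj U) U) V)) (op_mult S (op_adj V) V)"
    using assms(1,2) by (meson op_eq_refl op_eq_trans op_mult_cong op_mult_id_left)
  ultimately show ?thesis using assms(3) op_eq_trans by metis
qed

lemma layer_op_isometry:
  assumes "\<forall>g\<in>set gs. local_gate n \<kappa> g"
  shows "op_eq {..<n} (op_mult {..<n} (op_adj (layer_op n gs)) (layer_op n gs)) id_op"
proof -
  have "op_eq {..<n} (op_mult {..<n} (op_adj V) V) id_op"
    if "op_eq {..<n} (op_mult {..<n} (op_adj U) U) id_op" "V = fold (\<lambda>g. op_mult {..<n} (gate_op g)) gs U" for U V
    using assms that
  proof (induction gs arbitrary: U)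
    case (Cons g gs)
    then show ?case
      using op_mult_isometry[of "{..<n}" "gate_op g" U] gate_op_isometry[of "{..<n}" g]
      by (auto simp: local_gate_def)
  qed simp
  then show ?thesis
    unfolding layer_op_def using op_mult_id_left[of "{..<n}" id_op] by simp
qed

text \<open>The exponent is the Renyi-2 divergence from the maximally mixed state: it is at most \<open>n\<close> initially, and
  every noisy layer contracts it by the constant factor supplied by hypercontractivity.\<close>

lemma noisy_state_purity:
  fixes lam :: real and layers :: "nat \<Rightarrow> gate list"
  assumes lam: "0 < lam" "lam \<le> 1" and k: "((1 - lam) ^ 2 ^ Suc k)\<^sup>2 \<le> 1 / 8"
    and gates: "\<forall>l\<in>{1..L}. \<forall>g\<in>set (layers l). local_gate n \<kappa> g"
  defines "\<rho> \<equiv> noisy_state n lam layers L"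
  shows "op_psd {..<n} \<rho> \<and> op_tr {..<n} \<rho> = 1 \<and> op_adj \<rho> = \<rho> \<and>
    2 ^ n * (hs_norm {..<n} \<rho>)\<^sup>2 \<le> 2 powr (real n * (1 - (1 / 2) ^ k / 4) ^ L)"
  unfolding \<rho>_def using gates
proof (induction L)
  case 0
  have single: "(\<Sum>x\<in>Pow {..<n}. \<Sum>y\<in>Pow {..<n}. h x y) = h {} {}"
    if "\<And>x y. x \<noteq> {} \<or> y \<noteq> {} \<Longrightarrow> h x y = 0" for h :: "nat set \<Rightarrow> nat set \<Rightarrow> _"
  proof -
    have "(\<Sum>p\<in>Pow {..<n} \<times> Pow {..<n}. h (fst p) (snd p)) = (\<Sum>p\<in>{({}, {})}. h (fst p) (snd p))"
      by (intro sum.mono_neutral_right ballI that) (auto simp: prod_eq_iff)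
    then show ?thesis by (simp add: sum.cartesian_product case_prod_beta)
  qed
  have "op_psd {..<n} zero_state"
    unfolding op_psd_def
  proof
    fix v :: "nat set \<Rightarrow> complex"
    have "(\<Sum>x\<in>Pow {..<n}. \<Sum>y\<in>Pow {..<n}. cnj (v x) * zero_state x y * v y) = cnj (v {}) * zero_state {} {} * v {}"
      by (intro single) (auto simp: zero_state_def)
    then show "0 \<le> Re (\<Sum>x\<in>Pow {..<n}. \<Sum>y\<in>Pow {..<n}. cnj (v x) * zero_state x y * v y)"
      by (simp add: zero_state_def)
  qed
  moreover have "(hs_norm {..<n} zero_state)\<^sup>2 = 1"
    unfolding hs_norm_square by (subst single) (auto simp: zero_state_def)
  moreover have "op_tr {..<n} zero_state = 1"
  proof -
    have "op_tr {..<n} zero_state = (\<Sum>x\<in>{{}}. zero_state x x)"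
      unfolding op_tr_def by (intro sum.mono_neutral_right) (auto simp: zero_state_def)
    then show ?thesis by (simp add: zero_state_def)
  qed
  moreover have "op_adj zero_state = zero_state"
    by (auto simp: op_adj_def zero_state_def fun_eq_iff)
  ultimately show ?case by (simp add: powr_realpow)
next
  case (Suc L)
  let ?S = "{..<n}" and ?\<gamma> = "1 - (1 / 2) ^ k / 4 :: real"
  define X where "X = noisy_state n lam layers L"
  define U where "U = layer_op n (layers (Suc L))"
  define W where "W = conj_map n U X"
  have prev: "\<forall>l\<in>{1..L}. \<forall>g\<in>set (layers l). local_gate n \<kappa> g"
    using Suc.prems by auto
  have X: "op_psd ?S X" "op_tr ?S X = 1" "op_adj X = X"
      "2 ^ n * (hs_norm ?S X)\<^sup>2 \<le> 2 powr (real n * ?\<gamma> ^ L)"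
    using Suc.IH[OF prev] by (simp_all add: X_def)
  have U: "op_eq ?S (op_mult ?S (op_adj U) U) id_op"
    unfolding U_def using Suc.prems by (intro layer_op_isometry) auto
  have W: "op_psd ?S W" "op_tr ?S W = 1" "hs_norm ?S W = hs_norm ?S X"
    using X U by (simp_all add: W_def conj_map_def op_psd_conj op_tr_conj_unitary hs_norm_conj_unitary)
  have W': "op_adj W = W"
    by (simp add: W_def conj_map_def op_adj_mult op_mult_assoc X(3))
  have "(1 / 2 :: real) ^ k \<le> 1" by (simp add: power_le_one)
  then have \<gamma>: "0 \<le> ?\<gamma>" by simp
  have "2 ^ n * (hs_norm ?S (tensor_power_map n (depol lam) W))\<^sup>2 \<le> (2 ^ n * (hs_norm ?S W)\<^sup>2) powr ?\<gamma>"
    using noise_norm_le[OF W(1,2) W', of "1 - lam" k] lam k by simp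
  also have "\<dots> \<le> (2 powr (real n * ?\<gamma> ^ L)) powr ?\<gamma>"
    unfolding W(3) using X(4) \<gamma> by (intro powr_mono2) auto
  also have "\<dots> = 2 powr (real n * ?\<gamma> ^ Suc L)"
    by (simp add: powr_powr mult_ac)
  finally show ?case
    using W W' lam by (simp add: noisy_layer_def W_def[symmetric] X_def[symmetric] U_def[symmetric]
        op_psd_tensor_power_depol op_tr_tensor_power_depol op_adj_tensor_power_depol)
qed

section \<open>Singular value decomposition\<close>

text \<open>Vectors are functions of which only the values on \<open>P\<close> count. In the
  application an index is a pair of basis states, that is, a matrix position on one side of the
  cut.\<close>

definition vec_inner :: "'a set \<Rightarrow> ('a \<Rightarrow> complex) \<Rightarrow> ('a \<Rightarrow> complex) \<Rightarrow> complex" where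
  "vec_inner P u v = (\<Sum>p\<in>P. cnj (u p) * v p)"

lemma vec_inner_self: "vec_inner P u u = of_real (\<Sum>p\<in>P. (cmod (u p))\<^sup>2)"
  unfolding vec_inner_def by (simp only: of_real_sum complex_norm_square mult.commute)

lemma vec_inner_self_eq_0: "finite P \<Longrightarrow> vec_inner P u u = 0 \<longleftrightarrow> (\<forall>p\<in>P. u p = 0)"
  unfolding vec_inner_self of_real_eq_0_iff by (simp add: sum_nonneg_eq_0_iff)

lemma vec_inner_commute: "vec_inner P u v = cnj (vec_inner P v u)"
  by (simp add: vec_inner_def mult.commute)

text \<open>In the full function space the unit sphere is not compact when values outside
  \<open>P\<close> are free. The maximum is taken over the representatives that vanish outside
  \<open>P\<close>, a closed subset of a product of discs and points, compact by Tychonoff; the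
  locality of \<open>\<phi>\<close> carries the maximum back to all unit vectors.\<close>

lemma unit_sphere_attains_max:
  fixes \<phi> :: "('a \<Rightarrow> complex) \<Rightarrow> real"
  assumes P: "finite P" "P \<noteq> {}" and cont: "continuous_on UNIV \<phi>"
    and local: "\<And>u u'. (\<And>p. p \<in> P \<Longrightarrow> u p = u' p) \<Longrightarrow> \<phi> u = \<phi> u'"
  obtains u where "vec_inner P u u = 1" "\<And>w. vec_inner P w w = 1 \<Longrightarrow> \<phi> w \<le> \<phi> u"
proof -
  define B where "B = (\<lambda>p. if p \<in> P then cball 0 1 else {0 :: complex})"
  define K where "K = PiE UNIV B \<inter> {u. (\<Sum>p\<in>P. (cmod (u p))\<^sup>2) = 1}"
  have "compactin (product_topology (\<lambda>_. euclidean) UNIV) (PiE UNIV B)"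
    by (subst compactin_PiE) (simp add: B_def)
  then have "compact (PiE UNIV B)"
    by (simp add: euclidean_product_topology)
  moreover have "closed {u :: 'a \<Rightarrow> complex. (\<Sum>p\<in>P. (cmod (u p))\<^sup>2) = 1}"
    by (intro closed_Collect_eq continuous_intros continuous_on_product_coordinates)
  ultimately have K: "compact K" unfolding K_def by (rule compact_Int_closed)
  have restrict: "\<exists>w\<in>K. \<forall>p\<in>P. w p = u p" if u: "vec_inner P u u = 1" for u
  proof -
    define w where "w p = (if p \<in> P then u p else 0)" for p
    have s: "(\<Sum>p\<in>P. (cmod (u p))\<^sup>2) = 1"
      using u unfolding vec_inner_self by (metis of_real_eq_1_iff)
    have "cmod (u p) \<le> 1" if "p \<in> P" for p
    proof -
      have "(cmod (u p))\<^sup>2 \<le> 1"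
        using member_le_sum[of p P "\<lambda>p. (cmod (u p))\<^sup>2"] that P s by simp
      then show ?thesis by (simp add: power_le_one_iff abs_square_le_1)
    qed
    then have "w \<in> K" using s by (simp add: K_def w_def B_def PiE_def Pi_def)
    then show ?thesis by (intro bexI[of _ w]) (simp_all add: w_def)
  qed
  obtain p0 where p0: "p0 \<in> P" using P by auto
  have "vec_inner P (\<lambda>p. if p = p0 then 1 else 0) (\<lambda>p. if p = p0 then 1 else 0) = 1"
    using p0 P by (simp add: vec_inner_def if_distrib if_distribR sum.delta cong: if_cong)
  then have "K \<noteq> {}" using restrict by blast
  then obtain u where u: "u \<in> K" "\<forall>w\<in>K. \<phi> w \<le> \<phi> u"
    using continuous_attains_sup[OF K _ continuous_on_subset[OF cont]] by blast
  show thesis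
  proof
    show "vec_inner P u u = 1" using u by (simp add: K_def vec_inner_self)
  next
    fix w assume "vec_inner P w w = 1"
    then obtain w' where "w' \<in> K" "\<forall>p\<in>P. w' p = w p" using restrict by blast
    then show "\<phi> w \<le> \<phi> u" using u(2) local[of w' w] by auto
  qed
qed

text \<open>For small positive \<open>t\<close> the linear term dominates, and a positive
  \<open>a\<close> would make the expression negative. The chosen \<open>t\<close> is small enough
  that \<open>t * b\<close> is at most \<open>a\<close>.\<close>

lemma quadratic_nonneg_linear_zero:
  fixes a b :: real
  assumes "\<And>t. 0 \<le> t\<^sup>2 * b - 2 * t * a" "0 \<le> a"
  shows "a = 0"
proof (rule ccontr)
  assume "a \<noteq> 0"
  then have a: "0 < a" using assms(2) by simp
  define t where "t = a / (\<bar>b\<bar> + 1)"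
  have t: "0 < t" using a by (simp add: t_def add_nonneg_pos)
  have "t * b \<le> t * \<bar>b\<bar>" using t by (intro mult_left_mono) auto
  also have "\<dots> \<le> a"
    using a by (simp add: t_def field_simps)
  finally have "t * (t * b - 2 * a) < 0"
    using a t by (intro mult_pos_neg) auto
  then show False using assms(1)[of t] by (simp add: power2_eq_square algebra_simps)
qed

text \<open>\<open>R u\<close> is the row vector obtained by multiplying \<open>M\<close> from the
  left by the conjugate of \<open>u\<close>. A unit vector maximizing its norm is an eigenvector of
  M times its adjoint, because the first variation of the nonnegative form \<open>E\<close> vanishes
  where \<open>E\<close> does.\<close>

lemma top_singular_vector:
  fixes M :: "'a \<Rightarrow> 'b \<Rightarrow> complex"
  assumes P: "finite P" and Q: "finite Q" and M: "\<exists>p\<in>P. \<exists>q\<in>Q. M p q \<noteq> 0"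
  defines "R \<equiv> \<lambda>u q. \<Sum>p\<in>P. cnj (u p) * M p q"
  obtains u s where "0 < s" "vec_inner P u u = 1"
    "\<And>w. Re (vec_inner Q (R w) (R w)) \<le> s\<^sup>2 * Re (vec_inner P w w)"
    "vec_inner Q (R u) (R u) = of_real (s\<^sup>2)"
    "\<And>p. p \<in> P \<Longrightarrow> (\<Sum>q\<in>Q. M p q * cnj (R u q)) = of_real (s\<^sup>2) * u p"
proof -
  define \<phi> where "\<phi> u = (\<Sum>q\<in>Q. (cmod (R u q))\<^sup>2)" for u
  have \<phi>: "vec_inner Q (R u) (R u) = of_real (\<phi> u)" for u
    by (simp add: \<phi>_def vec_inner_self)
  have "continuous_on UNIV \<phi>"
    unfolding \<phi>_def R_def
    by (intro continuous_intros continuous_on_product_coordinates)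
  moreover have "P \<noteq> {}" using M by auto
  moreover have "\<phi> u = \<phi> u'" if "\<And>p. p \<in> P \<Longrightarrow> u p = u' p" for u u'
    using that by (simp add: \<phi>_def R_def)
  ultimately obtain u where u: "vec_inner P u u = 1" and max: "\<And>w. vec_inner P w w = 1 \<Longrightarrow> \<phi> w \<le> \<phi> u"
    using unit_sphere_attains_max[OF P] by metis
  define S where "S = \<phi> u"
  have R_scale: "R (\<lambda>p. c * w p) q = cnj c * R w q" for c w q
    by (simp add: R_def sum_distrib_left mult.assoc)
  have bound: "\<phi> w \<le> S * Re (vec_inner P w w)" for w
  proof (cases "vec_inner P w w = 0")
    case True
    then have "\<forall>p\<in>P. w p = 0" using vec_inner_self_eq_0[OF P] by blast
    then show ?thesis using True by (simp add: \<phi>_def R_def)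
  next
    case False
    define N where "N = (\<Sum>p\<in>P. (cmod (w p))\<^sup>2)"
    have N: "vec_inner P w w = of_real N"
      by (simp only: vec_inner_self N_def)
    moreover have "0 \<le> N" by (simp add: N_def sum_nonneg)
    ultimately have "0 < N" using False by (auto simp: less_le)
    note N = N this
    define c where "c = complex_of_real (1 / sqrt N)"
    have c: "cnj c * c = of_real (1 / N)" "(cmod c)\<^sup>2 = 1 / N"
      using N by (simp_all add: c_def power_divide norm_divide flip: of_real_mult)
    have "vec_inner P (\<lambda>p. c * w p) (\<lambda>p. c * w p) = (cnj c * c) * vec_inner P w w"
      by (simp add: vec_inner_def sum_distrib_left mult_ac)
    also have "\<dots> = 1" unfolding c N using N(2) by simp
    finally have "\<phi> (\<lambda>p. c * w p) \<le> S" unfolding S_def by (rule max)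
    moreover have "\<phi> (\<lambda>p. c * w p) = \<phi> w / N"
      unfolding \<phi>_def R_scale norm_mult power_mult_distrib complex_mod_cnj c(2) by (simp add: sum_divide_distrib)
    ultimately show ?thesis using N by (simp add: field_simps)
  qed
  have "0 < S"
  proof -
    obtain p q where pq: "p \<in> P" "q \<in> Q" "M p q \<noteq> 0" using M by auto
    define e where "e p' = (if p' = p then 1 else 0 :: complex)" for p'
    have "R e q = (\<Sum>p'\<in>P. if p' = p then M p' q else 0)"
      unfolding R_def by (intro sum.cong) (auto simp: e_def)
    then have "R e q = M p q" using P pq by simp
    then have "0 < \<phi> e"
      unfolding \<phi>_def using pq Q by (intro sum_pos2[of _ q]) auto
    also have "\<dots> \<le> S * Re (vec_inner P e e)" by (rule bound)
    finally show ?thesis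
      unfolding vec_inner_self by (simp add: sum_nonneg zero_less_mult_iff not_less leD)
  qed
  \<comment> \<open>\<open>G\<close> is M times its adjoint applied to \<open>u\<close>, and
    \<open>w\<close> is half the gradient of \<open>E\<close> at \<open>u\<close>. Moving from
    \<open>u\<close> against \<open>w\<close> changes \<open>E\<close> by -2t |w|^2 to first order,
    so nonnegativity of \<open>E\<close> forces \<open>w\<close> to vanish on
    \<open>P\<close>.\<close>
  define G where "G p = (\<Sum>q\<in>Q. M p q * cnj (R u q))" for p
  define w where "w p = of_real S * u p - G p" for p
  define E where "E h = S * Re (vec_inner P h h) - \<phi> h" for h
  have "w p = 0" if "p \<in> P" for p
  proof -
    have pol: "Re (vec_inner Q (R u) (R w)) = Re (vec_inner P w G)"
    proof -
      have "vec_inner P w G = (\<Sum>q\<in>Q. \<Sum>p\<in>P. cnj (w p) * M p q * cnj (R u q))"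
        unfolding vec_inner_def G_def sum_distrib_left by (subst sum.swap) (simp add: mult.assoc)
      also have "\<dots> = vec_inner Q (R u) (R w)"
        by (simp add: vec_inner_def R_def sum_distrib_right sum_distrib_left mult_ac)
      finally show ?thesis by simp
    qed
    have "0 \<le> t\<^sup>2 * E w - 2 * t * Re (vec_inner P w w)" for t
    proof -
      define h where "h p = u p - of_real t * w p" for p
      have Rh: "R h q = R u q - of_real t * R w q" for q
        by (simp add: R_def h_def algebra_simps sum_subtractf sum_distrib_left)
      have "vec_inner Q (R h) (R h) = vec_inner Q (R u) (R u) - of_real t * (vec_inner Q (R u) (R w) + cnj (vec_inner Q (R u) (R w)))
          + of_real (t\<^sup>2) * vec_inner Q (R w) (R w)"
        unfolding vec_inner_def
        by (simp add: Rh algebra_simps sum_subtractf sum.distrib sum_distrib_left power2_eq_square)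
      then have h1: "\<phi> h = S - 2 * t * Re (vec_inner P w G) + t\<^sup>2 * \<phi> w"
        using pol unfolding \<phi> by (drule_tac arg_cong[where f = Re]) (simp add: S_def del: of_real_power)
      have "vec_inner P h h = vec_inner P u u - of_real t * (vec_inner P w u + cnj (vec_inner P w u))
          + of_real (t\<^sup>2) * vec_inner P w w"
        unfolding vec_inner_def
        by (simp add: h_def algebra_simps sum_subtractf sum.distrib sum_distrib_left power2_eq_square)
      then have h2: "Re (vec_inner P h h) = 1 - 2 * t * Re (vec_inner P w u) + t\<^sup>2 * Re (vec_inner P w w)"
        using u by simp
      have "vec_inner P w w = of_real S * vec_inner P w u - vec_inner P w G"
        by (simp add: vec_inner_def w_def[where p = p for p] right_diff_distrib sum_subtractf sum_distrib_left mult.left_commute)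
      then have h3: "Re (vec_inner P w w) = S * Re (vec_inner P w u) - Re (vec_inner P w G)" by simp
      have "0 \<le> S * Re (vec_inner P h h) - \<phi> h" using bound[of h] by simp
      then show ?thesis
        unfolding h1 h2 E_def h3 by (simp add: algebra_simps)
    qed
    then have "Re (vec_inner P w w) = 0"
      by (rule quadratic_nonneg_linear_zero) (simp add: vec_inner_self sum_nonneg)
    then have "vec_inner P w w = 0"
      unfolding vec_inner_self by simp
    then show ?thesis using vec_inner_self_eq_0[OF P] that by blast
  qed
  then have G: "G p = of_real S * u p" if "p \<in> P" for p
    using that by (simp add: w_def)
  show thesis
  proof (rule that[of "sqrt S" u])
    show "Re (vec_inner Q (R w) (R w)) \<le> (sqrt S)\<^sup>2 * Re (vec_inner P w w)" for w
      using bound[of w] \<open>0 < S\<close> by (simp add: \<phi>)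
  qed (use \<open>0 < S\<close> u G in \<open>simp_all add: \<phi> S_def[symmetric] G_def\<close>)
qed

text \<open>The right factors enter without conjugation: \<open>v \<alpha>\<close> is the entrywise
  conjugate of the customary right singular vector. In this form each term reshapes directly into an
  \<open>op_tensor\<close>.\<close>

definition singular_value_decomposition ::
  "'a set \<Rightarrow> 'b set \<Rightarrow> ('a \<Rightarrow> 'b \<Rightarrow> complex) \<Rightarrow> nat \<Rightarrow> (nat \<Rightarrow> real) \<Rightarrow> (nat \<Rightarrow> 'a \<Rightarrow> complex) \<Rightarrow> (nat \<Rightarrow> 'b \<Rightarrow> complex) \<Rightarrow> bool" where
  "singular_value_decomposition P Q M r s u v \<longleftrightarrow>
     (\<forall>p\<in>P. \<forall>q\<in>Q. M p q = (\<Sum>\<alpha>=1..r. of_real (s \<alpha>) * (u \<alpha> p * v \<alpha> q))) \<and>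
     (\<forall>\<alpha>\<in>{1..r}. 0 < s \<alpha>) \<and>
     (\<forall>\<alpha>\<in>{1..r}. \<forall>\<beta>\<in>{1..r}. \<alpha> \<le> \<beta> \<longrightarrow> s \<beta> \<le> s \<alpha>) \<and>
     (\<forall>\<alpha>\<in>{1..r}. \<forall>\<beta>\<in>{1..r}. vec_inner P (u \<alpha>) (u \<beta>) = (if \<alpha> = \<beta> then 1 else 0)) \<and>
     (\<forall>\<alpha>\<in>{1..r}. \<forall>\<beta>\<in>{1..r}. vec_inner Q (v \<alpha>) (v \<beta>) = (if \<alpha> = \<beta> then 1 else 0))"

lemma singular_value_decomposition_left:
  assumes "singular_value_decomposition P Q M r s u v" "\<alpha> \<in> {1..r}" "q \<in> Q"
  shows "(\<Sum>p\<in>P. cnj (u \<alpha> p) * M p q) = of_real (s \<alpha>) * v \<alpha> q"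
proof -
  have "(\<Sum>p\<in>P. cnj (u \<alpha> p) * M p q) = (\<Sum>p\<in>P. \<Sum>\<beta>=1..r. of_real (s \<beta>) * v \<beta> q * (cnj (u \<alpha> p) * u \<beta> p))"
    using assms by (intro sum.cong) (simp_all add: singular_value_decomposition_def sum_distrib_left mult_ac)
  also have "\<dots> = (\<Sum>\<beta>=1..r. of_real (s \<beta>) * v \<beta> q * vec_inner P (u \<alpha>) (u \<beta>))"
    by (subst sum.swap) (simp add: vec_inner_def sum_distrib_left)
  also have "\<dots> = (\<Sum>\<beta>=1..r. if \<alpha> = \<beta> then of_real (s \<beta>) * v \<beta> q else 0)"
    using assms by (intro sum.cong) (auto simp: singular_value_decomposition_def)
  finally show ?thesis using assms(2) by (simp add: sum.delta)
qed

lemma singular_value_decomposition_right: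
  assumes "singular_value_decomposition P Q M r s u v" "\<alpha> \<in> {1..r}" "p \<in> P"
  shows "(\<Sum>q\<in>Q. M p q * cnj (v \<alpha> q)) = of_real (s \<alpha>) * u \<alpha> p"
proof -
  have "(\<Sum>q\<in>Q. M p q * cnj (v \<alpha> q)) = (\<Sum>q\<in>Q. \<Sum>\<beta>=1..r. of_real (s \<beta>) * u \<beta> p * (cnj (v \<alpha> q) * v \<beta> q))"
    using assms by (intro sum.cong) (simp_all add: singular_value_decomposition_def sum_distrib_left mult_ac)
  also have "\<dots> = (\<Sum>\<beta>=1..r. of_real (s \<beta>) * u \<beta> p * vec_inner Q (v \<alpha>) (v \<beta>))"
    by (subst sum.swap) (simp add: vec_inner_def sum_distrib_left)
  also have "\<dots> = (\<Sum>\<beta>=1..r. if \<alpha> = \<beta> then of_real (s \<beta>) * u \<beta> p else 0)"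
    using assms by (intro sum.cong) (auto simp: singular_value_decomposition_def)
  finally show ?thesis using assms(2) by (simp add: sum.delta)
qed

text \<open>Deflation: once the top term is subtracted, \<open>x\<close> annihilates the remainder
  from the left and the conjugate of \<open>y\<close> from the right. Singular vectors of the
  remainder with positive singular value are therefore orthogonal to \<open>x\<close> and
  \<open>y\<close>, and the new term can be placed in front.\<close>

lemma singular_value_decomposition_Cons:
  assumes svd: "singular_value_decomposition P Q (\<lambda>p q. M p q - of_real t * (x p * y q)) r s u v"
    and t: "0 < t" and x: "vec_inner P x x = 1" and y: "vec_inner Q y y = 1"
    and xM: "\<And>q. q \<in> Q \<Longrightarrow> (\<Sum>p\<in>P. cnj (x p) * M p q) = of_real t * y q"
    and My: "\<And>p. p \<in> P \<Longrightarrow> (\<Sum>q\<in>Q. M p q * cnj (y q)) = of_real t * x p"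
    and top: "\<And>w. Re (vec_inner Q (\<lambda>q. \<Sum>p\<in>P. cnj (w p) * M p q) (\<lambda>q. \<Sum>p\<in>P. cnj (w p) * M p q)) \<le> t\<^sup>2 * Re (vec_inner P w w)"
  shows "singular_value_decomposition P Q M (Suc r) (\<lambda>\<alpha>. if \<alpha> = 1 then t else s (\<alpha> - 1))
    (\<lambda>\<alpha>. if \<alpha> = 1 then x else u (\<alpha> - 1)) (\<lambda>\<alpha>. if \<alpha> = 1 then y else v (\<alpha> - 1))"
proof -
  let ?M = "\<lambda>p q. M p q - of_real t * (x p * y q)"
  have s: "0 < s \<alpha>" if "\<alpha> \<in> {1..r}" for \<alpha>
    using svd that by (simp add: singular_value_decomposition_def)
  have uu: "vec_inner P (u \<alpha>) (u \<alpha>) = 1" and vv: "vec_inner Q (v \<alpha>) (v \<alpha>) = 1" if "\<alpha> \<in> {1..r}" for \<alpha>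
    using svd that by (simp_all add: singular_value_decomposition_def)
  have xM': "(\<Sum>p\<in>P. cnj (x p) * ?M p q) = 0" if "q \<in> Q" for q
  proof -
    have "(\<Sum>p\<in>P. cnj (x p) * ?M p q) = (\<Sum>p\<in>P. cnj (x p) * M p q) - of_real t * y q * vec_inner P x x"
      by (simp add: vec_inner_def right_diff_distrib sum_subtractf sum_distrib_left mult_ac)
    then show ?thesis using xM[OF that] x by simp
  qed
  have My': "(\<Sum>q\<in>Q. ?M p q * cnj (y q)) = 0" if "p \<in> P" for p
  proof -
    have "(\<Sum>q\<in>Q. ?M p q * cnj (y q)) = (\<Sum>q\<in>Q. M p q * cnj (y q)) - of_real t * x p * vec_inner Q y y"
      by (simp add: vec_inner_def left_diff_distrib right_diff_distrib sum_subtractf sum_distrib_left mult_ac)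
    then show ?thesis using My[OF that] y by simp
  qed
  have xu: "vec_inner P x (u \<alpha>) = 0" if \<alpha>: "\<alpha> \<in> {1..r}" for \<alpha>
  proof -
    have "of_real (s \<alpha>) * vec_inner P x (u \<alpha>) = (\<Sum>p\<in>P. cnj (x p) * (\<Sum>q\<in>Q. ?M p q * cnj (v \<alpha> q)))"
      unfolding vec_inner_def sum_distrib_left[of "of_real (s \<alpha>)"]
      by (intro sum.cong refl) (simp only: singular_value_decomposition_right[OF svd \<alpha>], simp)
    also have "\<dots> = (\<Sum>q\<in>Q. (\<Sum>p\<in>P. cnj (x p) * ?M p q) * cnj (v \<alpha> q))"
      unfolding sum_distrib_left sum_distrib_right by (subst sum.swap) (simp only: mult.assoc)
    also have "\<dots> = 0" by (intro sum.neutral ballI) (simp only: xM', simp)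
    finally show ?thesis using s[OF \<alpha>] by simp
  qed
  have yv: "vec_inner Q y (v \<alpha>) = 0" if \<alpha>: "\<alpha> \<in> {1..r}" for \<alpha>
  proof -
    have "of_real (s \<alpha>) * vec_inner Q y (v \<alpha>) = (\<Sum>q\<in>Q. cnj (y q) * (\<Sum>p\<in>P. cnj (u \<alpha> p) * ?M p q))"
      unfolding vec_inner_def sum_distrib_left[of "of_real (s \<alpha>)"]
      by (intro sum.cong refl) (simp only: singular_value_decomposition_left[OF svd \<alpha>], simp)
    also have "\<dots> = (\<Sum>p\<in>P. (\<Sum>q\<in>Q. ?M p q * cnj (y q)) * cnj (u \<alpha> p))"
      unfolding sum_distrib_left sum_distrib_right by (subst sum.swap) (simp only: mult_ac)
    also have "\<dots> = 0" by (intro sum.neutral ballI) (simp only: My', simp)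
    finally show ?thesis using s[OF \<alpha>] by simp
  qed
  \<comment> \<open>Being orthogonal to \<open>x\<close>, the vector \<open>u \<alpha>\<close> sees
    no difference between \<open>M\<close> and the remainder, so its singular value is subject to
    the maximality of \<open>t\<close>.\<close>
  have st: "s \<alpha> \<le> t" if \<alpha>: "\<alpha> \<in> {1..r}" for \<alpha>
  proof -
    have ux: "(\<Sum>p\<in>P. cnj (u \<alpha> p) * x p) = 0"
      using xu[OF \<alpha>] vec_inner_commute[of P "u \<alpha>" x] by (simp add: vec_inner_def)
    have row: "(\<Sum>p\<in>P. cnj (u \<alpha> p) * M p q) = of_real (s \<alpha>) * v \<alpha> q" if "q \<in> Q" for q
    proof -
      have "(\<Sum>p\<in>P. cnj (u \<alpha> p) * ?M p q)
          = (\<Sum>p\<in>P. cnj (u \<alpha> p) * M p q) - of_real t * y q * (\<Sum>p\<in>P. cnj (u \<alpha> p) * x p)"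
        by (simp add: right_diff_distrib sum_subtractf sum_distrib_left mult_ac)
      then show ?thesis using singular_value_decomposition_left[OF svd \<alpha> that] ux by simp
    qed
    have "vec_inner Q (\<lambda>q. \<Sum>p\<in>P. cnj (u \<alpha> p) * M p q) (\<lambda>q. \<Sum>p\<in>P. cnj (u \<alpha> p) * M p q)
        = vec_inner Q (\<lambda>q. of_real (s \<alpha>) * v \<alpha> q) (\<lambda>q. of_real (s \<alpha>) * v \<alpha> q)"
      unfolding vec_inner_def by (intro sum.cong) (simp_all only: row)
    also have "\<dots> = of_real ((s \<alpha>)\<^sup>2) * vec_inner Q (v \<alpha>) (v \<alpha>)"
      by (simp add: vec_inner_def sum_distrib_left power2_eq_square mult_ac)
    finally have "Re (of_real ((s \<alpha>)\<^sup>2) * vec_inner Q (v \<alpha>) (v \<alpha>)) \<le> t\<^sup>2 * Re (vec_inner P (u \<alpha>) (u \<alpha>))"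
      using top[of "u \<alpha>"] by (simp only:)
    then have "(s \<alpha>)\<^sup>2 \<le> t\<^sup>2"
      unfolding uu[OF \<alpha>] vv[OF \<alpha>] by simp
    then show ?thesis using t by (rule power2_le_imp_le[OF _ less_imp_le])
  qed
  have M: "M p q = of_real t * (x p * y q) + (\<Sum>\<alpha>=1..r. of_real (s \<alpha>) * (u \<alpha> p * v \<alpha> q))"
    if "p \<in> P" "q \<in> Q" for p q
  proof -
    have "M p q - of_real t * (x p * y q) = (\<Sum>\<alpha>=1..r. of_real (s \<alpha>) * (u \<alpha> p * v \<alpha> q))"
      using svd that unfolding singular_value_decomposition_def by blast
    then show ?thesis by (simp add: algebra_simps)
  qed
  have index: "\<alpha> = 1 \<or> \<alpha> \<noteq> 1 \<and> \<alpha> - 1 \<in> {1..r}" if "\<alpha> \<in> {1..Suc r}" for \<alpha>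
    using that by auto
  have sorted: "s \<beta> \<le> s \<alpha>" if "\<alpha> \<in> {1..r}" "\<beta> \<in> {1..r}" "\<alpha> \<le> \<beta>" for \<alpha> \<beta>
    using svd that unfolding singular_value_decomposition_def by blast
  have orth: "vec_inner P (u \<alpha>) (u \<beta>) = (if \<alpha> = \<beta> then 1 else 0)" "vec_inner Q (v \<alpha>) (v \<beta>) = (if \<alpha> = \<beta> then 1 else 0)"
    if "\<alpha> \<in> {1..r}" "\<beta> \<in> {1..r}" for \<alpha> \<beta>
    using svd that unfolding singular_value_decomposition_def by blast+
  have ux: "vec_inner P (u \<alpha>) x = 0" and vy: "vec_inner Q (v \<alpha>) y = 0" if "\<alpha> \<in> {1..r}" for \<alpha>
    using xu[OF that] yv[OF that] by (simp_all add: vec_inner_commute[of P "u \<alpha>"] vec_inner_commute[of Q "v \<alpha>"])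
  have shift: "(\<Sum>\<alpha>=1..Suc r. F \<alpha>) = F 1 + (\<Sum>\<alpha>=1..r. F (Suc \<alpha>))" for F :: "nat \<Rightarrow> complex"
    by (induction r) simp_all
  show ?thesis
    unfolding singular_value_decomposition_def
  proof (intro conjI ballI impI)
    fix p q assume "p \<in> P" "q \<in> Q"
    then show "M p q = (\<Sum>\<alpha>=1..Suc r. of_real (if \<alpha> = 1 then t else s (\<alpha> - 1)) *
        ((if \<alpha> = 1 then x else u (\<alpha> - 1)) p * (if \<alpha> = 1 then y else v (\<alpha> - 1)) q))"
      unfolding shift M[OF \<open>p \<in> P\<close> \<open>q \<in> Q\<close>] by (auto intro!: sum.cong)
  next
    fix \<alpha> assume "\<alpha> \<in> {1..Suc r}"
    from index[OF this] show "0 < (if \<alpha> = 1 then t else s (\<alpha> - 1))"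
      using t s by auto
  next
    fix \<alpha> \<beta> assume "\<alpha> \<in> {1..Suc r}" "\<beta> \<in> {1..Suc r}" "\<alpha> \<le> \<beta>"
    with index[OF this(1)] index[OF this(2)]
    show "(if \<beta> = 1 then t else s (\<beta> - 1)) \<le> (if \<alpha> = 1 then t else s (\<alpha> - 1))"
      using st sorted[of "\<alpha> - 1" "\<beta> - 1"] by auto
  next
    fix \<alpha> \<beta> assume "\<alpha> \<in> {1..Suc r}" "\<beta> \<in> {1..Suc r}"
    note ind = index[OF this(1)] index[OF this(2)]
    have eq: "\<alpha> - 1 = \<beta> - 1 \<longleftrightarrow> \<alpha> = \<beta>" if "\<alpha> \<noteq> 1" "\<beta> \<noteq> 1"
      using that \<open>\<alpha> \<in> {1..Suc r}\<close> \<open>\<beta> \<in> {1..Suc r}\<close> by auto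
    show "vec_inner P (if \<alpha> = 1 then x else u (\<alpha> - 1)) (if \<beta> = 1 then x else u (\<beta> - 1)) = (if \<alpha> = \<beta> then 1 else 0)"
      using ind eq by (elim disjE conjE) (simp_all only: if_True if_False orth x xu ux refl, auto)
    show "vec_inner Q (if \<alpha> = 1 then y else v (\<alpha> - 1)) (if \<beta> = 1 then y else v (\<beta> - 1)) = (if \<alpha> = \<beta> then 1 else 0)"
      using ind eq by (elim disjE conjE) (simp_all only: if_True if_False orth y yv vy refl, auto)
  qed
qed

text \<open>Induction on the number of product terms, not on a dimension, yields the bound on
  \<open>r\<close> together with existence. The point to prove is that removing the top singular
  term leaves a matrix that is a sum of one product fewer.\<close>

theorem singular_value_decomposition_exists:
  fixes M :: "'a \<Rightarrow> 'b \<Rightarrow> complex" and a :: "'i \<Rightarrow> 'a \<Rightarrow> complex"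
  assumes PQ: "finite P" "finite Q" and "finite I"
    and "\<And>p q. p \<in> P \<Longrightarrow> q \<in> Q \<Longrightarrow> M p q = (\<Sum>k\<in>I. a k p * b k q)"
  shows "\<exists>r s u v. r \<le> card I \<and> singular_value_decomposition P Q M r s u v"
  using assms(3,4)
proof (induction "card I" arbitrary: I M a b)
  case 0
  then have "M p q = 0" if "p \<in> P" "q \<in> Q" for p q
    using that by auto
  then have "singular_value_decomposition P Q M 0 undefined undefined undefined"
    by (simp add: singular_value_decomposition_def)
  then show ?case by blast
next
  case (Suc n)
  show ?case
  proof (cases "\<exists>p\<in>P. \<exists>q\<in>Q. M p q \<noteq> 0")
    case False
    then have "singular_value_decomposition P Q M 0 undefined undefined undefined"
      by (auto simp: singular_value_decomposition_def)
    then show ?thesis by blast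
  next
    case True
    let ?R = "\<lambda>u q. \<Sum>p\<in>P. cnj (u p) * M p q"
    obtain t x where t: "0 < t" and x: "vec_inner P x x = 1"
      and top: "\<And>w. Re (vec_inner Q (?R w) (?R w)) \<le> t\<^sup>2 * Re (vec_inner P w w)"
      and Rx0: "vec_inner Q (?R x) (?R x) = of_real (t\<^sup>2)"
      and MR0: "\<And>p. p \<in> P \<Longrightarrow> (\<Sum>q\<in>Q. M p q * cnj (?R x q)) = of_real (t\<^sup>2) * x p"
      by (rule top_singular_vector[OF PQ True]) (rule that)
    define R where "R = ?R x"
    have R_def': "R q = (\<Sum>p\<in>P. cnj (x p) * M p q)" for q by (simp add: R_def)
    note Rx = Rx0[folded R_def]
    have MR: "(\<Sum>q\<in>Q. M p q * cnj (R q)) = of_real (t\<^sup>2) * x p" if "p \<in> P" for p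
      unfolding R_def' using MR0[OF that] .
    define y where "y q = R q / of_real t" for q
    have Rxy: "R q = of_real t * y q" for q using t by (simp add: y_def)
    have "of_real (t\<^sup>2) * vec_inner Q y y = vec_inner Q R R"
      by (simp add: vec_inner_def Rxy sum_distrib_left power2_eq_square mult_ac)
    then have y: "vec_inner Q y y = 1" using t unfolding Rx by simp
    have My: "(\<Sum>q\<in>Q. M p q * cnj (y q)) = of_real t * x p" if "p \<in> P" for p
    proof -
      have "of_real t * (\<Sum>q\<in>Q. M p q * cnj (y q)) = of_real t * (of_real t * x p)"
        using MR[OF that] by (simp add: Rxy sum_distrib_left power2_eq_square mult_ac)
      then show ?thesis using t by simp
    qed
    \<comment> \<open>\<open>a' k\<close> is \<open>a k\<close> projected onto the orthogonal
      complement of \<open>x\<close>. Projecting all left factors subtracts from \<open>M\<close>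
      exactly the top term, since \<open>x\<close> applied to \<open>M\<close> gives
      \<open>R\<close>. The \<open>c k\<close> are the coefficients in the eigenvector equation that
      expands \<open>x\<close>, up to t^2, in the \<open>a k\<close>.\<close>
    define a' where "a' k p = a k p - vec_inner P x (a k) * x p" for k p
    define c where "c k = (\<Sum>q\<in>Q. b k q * cnj (R q))" for k
    have Rb: "R q = (\<Sum>k\<in>I. vec_inner P x (a k) * b k q)" if "q \<in> Q" for q
    proof -
      have "R q = (\<Sum>p\<in>P. \<Sum>k\<in>I. cnj (x p) * a k p * b k q)"
        unfolding R_def' using Suc.prems(2) that by (intro sum.cong) (simp_all add: sum_distrib_left mult.assoc)
      then show ?thesis by (subst (asm) sum.swap) (simp add: vec_inner_def sum_distrib_right)
    qed
    have M': "M p q - of_real t * (x p * y q) = (\<Sum>k\<in>I. a' k p * b k q)" if "p \<in> P" "q \<in> Q" for p q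
    proof -
      have "(\<Sum>k\<in>I. a' k p * b k q) = M p q - x p * R q"
        using Suc.prems(2)[OF that] Rb[OF that(2)]
        by (simp add: a'_def left_diff_distrib right_diff_distrib sum_subtractf sum_distrib_left mult_ac)
      then show ?thesis by (simp add: Rxy mult_ac)
    qed
    have xc: "of_real (t\<^sup>2) * x p = (\<Sum>k\<in>I. c k * a k p)" if "p \<in> P" for p
    proof -
      have "of_real (t\<^sup>2) * x p = (\<Sum>q\<in>Q. \<Sum>k\<in>I. a k p * b k q * cnj (R q))"
        unfolding MR[OF that, symmetric] using Suc.prems(2) that
        by (intro sum.cong) (simp_all add: sum_distrib_right)
      then show ?thesis by (subst (asm) sum.swap) (simp add: c_def sum_distrib_left mult_ac)
    qed
    text \<open>The top left singular vector lies in the span of the \<open>a k\<close>, and projecting it out annihilates it;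
      so one of the projected vectors is a combination of the others.\<close>
    have ca': "(\<Sum>k\<in>I. c k * a' k p) = 0" if "p \<in> P" for p
    proof -
      have "of_real (t\<^sup>2) = of_real (t\<^sup>2) * vec_inner P x x" using x by simp
      also have "\<dots> = (\<Sum>p\<in>P. cnj (x p) * (of_real (t\<^sup>2) * x p))"
        by (simp add: vec_inner_def sum_distrib_left mult_ac)
      also have "\<dots> = (\<Sum>p\<in>P. cnj (x p) * (\<Sum>k\<in>I. c k * a k p))"
        by (intro sum.cong refl) (simp only: xc)
      also have "\<dots> = (\<Sum>k\<in>I. c k * vec_inner P x (a k))"
        unfolding vec_inner_def sum_distrib_left by (subst sum.swap) (simp add: mult_ac)
      finally have 1: "(\<Sum>k\<in>I. c k * vec_inner P x (a k)) = of_real (t\<^sup>2)" ..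
      have "(\<Sum>k\<in>I. c k * a' k p) = (\<Sum>k\<in>I. c k * a k p) - (\<Sum>k\<in>I. c k * vec_inner P x (a k)) * x p"
        by (simp add: a'_def left_diff_distrib right_diff_distrib sum_subtractf sum_distrib_left sum_distrib_right mult_ac)
      then show ?thesis unfolding 1 xc[OF that, symmetric] by simp
    qed
    have "\<exists>j\<in>I. c j \<noteq> 0"
    proof (rule ccontr)
      assume "\<not> (\<exists>j\<in>I. c j \<noteq> 0)"
      then have "of_real (t\<^sup>2) * x p = 0" if "p \<in> P" for p using xc[OF that] by simp
      then have "\<forall>p\<in>P. x p = 0" using t by simp
      then have "vec_inner P x x = 0" by (simp add: vec_inner_def)
      then show False using x by simp
    qed
    then obtain j where j: "j \<in> I" "c j \<noteq> 0" by blast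
    \<comment> \<open>Solving the relation \<open>ca'\<close> for \<open>a' j\<close> eliminates the
      term \<open>j\<close> and shifts its right factor onto the remaining ones.\<close>
    define b' where "b' k q = b k q - c k / c j * b j q" for k q
    have "M p q - of_real t * (x p * y q) = (\<Sum>k\<in>I - {j}. a' k p * b' k q)" if pq: "p \<in> P" "q \<in> Q" for p q
    proof -
      have "c j * a' j p = - (\<Sum>k\<in>I - {j}. c k * a' k p)"
        using ca'[OF pq(1)] sum.remove[OF Suc.prems(1) j(1), of "\<lambda>k. c k * a' k p"]
        by (simp add: eq_neg_iff_add_eq_0)
      then have "a' j p = - (\<Sum>k\<in>I - {j}. c k * a' k p) / c j"
        using j(2) by (metis nonzero_mult_div_cancel_left)
      then have aj: "a' j p = - (\<Sum>k\<in>I - {j}. c k / c j * a' k p)"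
        by (simp add: sum_divide_distrib)
      have "(\<Sum>k\<in>I. a' k p * b k q) = a' j p * b j q + (\<Sum>k\<in>I - {j}. a' k p * b k q)"
        by (rule sum.remove[OF Suc.prems(1) j(1)])
      also have "\<dots> = (\<Sum>k\<in>I - {j}. a' k p * b' k q)"
        unfolding aj by (simp add: b'_def left_diff_distrib right_diff_distrib sum_subtractf sum_distrib_left sum_distrib_right mult_ac)
      finally show ?thesis using M'[OF pq] by simp
    qed
    moreover have card: "n = card (I - {j})" "finite (I - {j})"
      using Suc.hyps(2) Suc.prems(1) j(1) by auto
    ultimately obtain r s u v where r: "r \<le> n"
      and svd: "singular_value_decomposition P Q (\<lambda>p q. M p q - of_real t * (x p * y q)) r s u v"
      using Suc.hyps(1)[OF card, of "\<lambda>p q. M p q - of_real t * (x p * y q)" a' b'] by blast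
    have "(\<Sum>p\<in>P. cnj (x p) * M p q) = of_real t * y q" for q
      using Rxy[of q] by (simp add: R_def')
    from singular_value_decomposition_Cons[OF svd t x y this My top]
    have "\<exists>s u v. singular_value_decomposition P Q M (Suc r) s u v" by blast
    moreover have "Suc r \<le> card I" using r Suc.hyps(2) by simp
    ultimately show ?thesis by blast
  qed
qed

section \<open>Operator Schmidt rank\<close>

text \<open>An upper bound on the operator Schmidt rank, phrased through arbitrary product
  expansions because these behave well under products and noise; orthonormality is produced only at
  the end. The bound variable needs a fixed index type, and \<open>op_rank_leI\<close> accepts
  finite index sets of any type.\<close>

definition op_rank_le :: "nat set \<Rightarrow> nat set \<Rightarrow> nat \<Rightarrow> qop \<Rightarrow> bool" where
  "op_rank_le S A K X \<longleftrightarrow> (\<exists>(I :: nat set) a b. finite I \<and> card I \<le> K \<and>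
     op_eq S X (\<lambda>x y. \<Sum>k\<in>I. op_tensor A (a k) (b k) x y))"

lemma op_rank_leI:
  fixes J :: "'i set"
  assumes "finite J" "card J \<le> K"
    and "\<And>x y. x \<in> Pow S \<Longrightarrow> y \<in> Pow S \<Longrightarrow> X x y = (\<Sum>k\<in>J. op_tensor A (a k) (b k) x y)"
  shows "op_rank_le S A K X"
proof -
  obtain h where h: "bij_betw h {0..<card J} J"
    using ex_bij_betw_nat_finite[OF assms(1)] by blast
  have "X x y = (\<Sum>k\<in>{0..<card J}. op_tensor A (a (h k)) (b (h k)) x y)" if "x \<in> Pow S" "y \<in> Pow S" for x y
    unfolding assms(3)[OF that] by (rule sum.reindex_bij_betw[OF h, symmetric])
  then have "op_eq S X (\<lambda>x y. \<Sum>k\<in>{0..<card J}. op_tensor A (a (h k)) (b (h k)) x y)"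
    by (simp add: op_eq_def)
  then show ?thesis
    unfolding op_rank_le_def using assms(2)
    by (intro exI[of _ "{0..<card J}"] exI[of _ "\<lambda>k. a (h k)"] exI[of _ "\<lambda>k. b (h k)"]) simp
qed

lemma op_rank_leE:
  assumes "op_rank_le S A K X"
  obtains I :: "nat set" and a b where "finite I" "card I \<le> K"
    "\<And>x y. x \<in> Pow S \<Longrightarrow> y \<in> Pow S \<Longrightarrow> X x y = (\<Sum>k\<in>I. op_tensor A (a k) (b k) x y)"
  using assms unfolding op_rank_le_def op_eq_def by blast

lemma op_rank_le_mono: "op_rank_le S A K X \<Longrightarrow> K \<le> K' \<Longrightarrow> op_rank_le S A K' X"
  unfolding op_rank_le_def by (meson order_trans)

lemma op_rank_le_mult:
  assumes S: "finite S" "A \<subseteq> S" and "op_rank_le S A K X" "op_rank_le S A K' Y"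
  shows "op_rank_le S A (K * K') (op_mult S X Y)"
proof -
  obtain I :: "nat set" and a b where I: "finite I" "card I \<le> K"
    and X: "\<And>x y. x \<in> Pow S \<Longrightarrow> y \<in> Pow S \<Longrightarrow> X x y = (\<Sum>k\<in>I. op_tensor A (a k) (b k) x y)"
    using assms(3) by (rule op_rank_leE) (rule that)
  obtain J :: "nat set" and c d where J: "finite J" "card J \<le> K'"
    and Y: "\<And>x y. x \<in> Pow S \<Longrightarrow> y \<in> Pow S \<Longrightarrow> Y x y = (\<Sum>k\<in>J. op_tensor A (c k) (d k) x y)"
    using assms(4) by (rule op_rank_leE) (rule that)
  show ?thesis
  proof (rule op_rank_leI)
    show "finite (I \<times> J)" "card (I \<times> J) \<le> K * K'"
      using I J by (simp_all add: card_cartesian_product mult_le_mono)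
    fix x y assume xy: "x \<in> Pow S" "y \<in> Pow S"
    have "op_mult S X Y x y = (\<Sum>z\<in>Pow S. \<Sum>(k, l)\<in>I \<times> J. op_tensor A (a k) (b k) x z * op_tensor A (c l) (d l) z y)"
      unfolding op_mult_def using X[OF xy(1)] Y[OF _ xy(2)]
      by (intro sum.cong refl) (simp add: sum_product sum.cartesian_product)
    also have "\<dots> = (\<Sum>(k, l)\<in>I \<times> J. op_mult S (op_tensor A (a k) (b k)) (op_tensor A (c l) (d l)) x y)"
      unfolding op_mult_def by (subst sum.swap) (simp add: case_prod_beta)
    finally show "op_mult S X Y x y = (\<Sum>kl\<in>I \<times> J. op_tensor A (op_mult A (a (fst kl)) (c (snd kl)))
        (op_mult (S - A) (b (fst kl)) (d (snd kl))) x y)"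
      unfolding op_tensor_mult[OF S] by (simp add: case_prod_beta)
  qed
qed

lemma op_rank_le_adj:
  assumes "op_rank_le S A K X"
  shows "op_rank_le S A K (op_adj X)"
proof -
  obtain I :: "nat set" and a b where I: "finite I" "card I \<le> K"
    and X: "\<And>x y. x \<in> Pow S \<Longrightarrow> y \<in> Pow S \<Longrightarrow> X x y = (\<Sum>k\<in>I. op_tensor A (a k) (b k) x y)"
    using assms by (rule op_rank_leE) (rule that)
  show ?thesis
    by (rule op_rank_leI[OF I, where a = "\<lambda>k. op_adj (a k)" and b = "\<lambda>k. op_adj (b k)"])
      (simp add: X op_adj_def op_tensor_def)
qed

lemma set_bit_of_Int_Diff:
  "set_bit_of i c x \<inter> A = (if i \<in> A then set_bit_of i c (x \<inter> A) else x \<inter> A)"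
  "set_bit_of i c x - A = (if i \<in> A then x - A else set_bit_of i c (x - A))"
  by (auto simp: set_bit_of_def)

text \<open>The qubit lies on one side of the cut, so by linearity its noise acts on one factor of
  each term and creates no new terms.\<close>

lemma op_rank_le_on_qubit_depol:
  assumes "i \<in> S" "op_rank_le S A K X"
  shows "op_rank_le S A K (on_qubit i (depol lam) X)"
proof -
  obtain I :: "nat set" and a b where I: "finite I" "card I \<le> K"
    and X: "\<And>x y. x \<in> Pow S \<Longrightarrow> y \<in> Pow S \<Longrightarrow> X x y = (\<Sum>k\<in>I. op_tensor A (a k) (b k) x y)"
    using assms(2) by (rule op_rank_leE) (rule that)
  define a' where "a' k = (if i \<in> A then on_qubit i (depol lam) (a k) else a k)" for k
  define b' where "b' k = (if i \<in> A then b k else on_qubit i (depol lam) (b k))" for k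
  show ?thesis
  proof (rule op_rank_leI[OF I, where a = a' and b = b'])
    fix x y assume xy: "x \<in> Pow S" "y \<in> Pow S"
    have sb: "set_bit_of i c z \<in> Pow S" if "z \<in> Pow S" for c z
      using that assms(1) by (auto simp: set_bit_of_def)
    have lin: "depol lam (\<lambda>c d. \<Sum>k\<in>I. F k c d) c' d' = (\<Sum>k\<in>I. depol lam (F k) c' d')" for F c' d'
      using I(1) by (induction I rule: finite_induct) (simp_all add: depol_def UNIV_bool algebra_simps add_divide_distrib)
    have "on_qubit i (depol lam) X x y
        = (\<Sum>k\<in>I. depol lam (\<lambda>c d. op_tensor A (a k) (b k) (set_bit_of i c x) (set_bit_of i d y)) (i \<in> x) (i \<in> y))"
      unfolding on_qubit_def X[OF sb[OF xy(1)] sb[OF xy(2)]] lin ..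
    also have "\<dots> = (\<Sum>k\<in>I. op_tensor A (a' k) (b' k) x y)"
      by (intro sum.cong refl)
        (auto simp: op_tensor_def set_bit_of_Int_Diff a'_def b'_def on_qubit_def depol_def UNIV_bool algebra_simps
          simp del: set_bit_of_simps)
    finally show "on_qubit i (depol lam) X x y = (\<Sum>k\<in>I. op_tensor A (a' k) (b' k) x y)" .
  qed
qed

lemma op_rank_le_tensor_power_depol:
  assumes "{..<n} \<subseteq> S" "op_rank_le S A K X"
  shows "op_rank_le S A K (tensor_power_map n (depol lam) X)"
  using assms(1)
  by (induction n) (auto simp: tensor_power_map_def assms(2) lessThan_Suc intro: op_rank_le_on_qubit_depol)

lemma op_tensor_swap: "op_tensor (- A) X Y = op_tensor A Y X"
proof -
  have "x - - A = x \<inter> A" "x \<inter> - A = x - A" for x :: "nat set" by auto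
  then show ?thesis by (simp add: op_tensor_def mult.commute)
qed

lemma op_rank_le_swap: "op_rank_le S (- A) K X \<Longrightarrow> op_rank_le S A K X"
  unfolding op_rank_le_def op_tensor_swap by blast

text \<open>Expansion in matrix units on the part of the support inside \<open>A\<close>.
  \<open>a pq\<close> is the matrix unit at position \<open>pq\<close>, extended by the identity to
  the rest of \<open>A\<close>; \<open>b pq\<close> is the corresponding block of the gate, extended
  likewise. For given \<open>x\<close> and \<open>y\<close> only one term is nonzero.\<close>

lemma op_rank_le_gate_op:
  assumes "finite (fst g)"
  shows "op_rank_le S A (4 ^ card (fst g \<inter> A)) (gate_op g)"
proof -
  let ?T = "fst g"
  let ?J = "Pow (?T \<inter> A) \<times> Pow (?T \<inter> A)"
  define a where "a pq x y = (if (x \<inter> ?T, y \<inter> ?T) = pq \<and> x - ?T = y - ?T then 1 else 0 :: complex)"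
    for pq :: "nat set \<times> nat set" and x y
  define b where "b pq x y = snd g (fst pq \<union> x \<inter> ?T) (snd pq \<union> y \<inter> ?T) * id_op (x - ?T) (y - ?T)"
    for pq :: "nat set \<times> nat set" and x y
  show ?thesis
  proof (rule op_rank_leI[where a = a and b = b])
    show fin: "finite ?J" using assms by auto
    have "card (Pow (?T \<inter> A)) = 2 ^ card (?T \<inter> A)"
      using assms by (intro card_Pow) auto
    then show "card ?J \<le> 4 ^ card (?T \<inter> A)"
      by (simp add: card_cartesian_product power_mult_distrib[symmetric])
    fix x y
    let ?p = "(x \<inter> A \<inter> ?T, y \<inter> A \<inter> ?T)"
    have p: "?p \<in> ?J" by auto
    have "x \<inter> A \<inter> ?T \<union> (x - A) \<inter> ?T = x \<inter> ?T" "y \<inter> A \<inter> ?T \<union> (y - A) \<inter> ?T = y \<inter> ?T" by auto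
    moreover have "x - ?T = y - ?T \<longleftrightarrow> x \<inter> A - ?T = y \<inter> A - ?T \<and> x - A - ?T = y - A - ?T" by blast
    ultimately have "gate_op g x y = op_tensor A (a ?p) (b ?p) x y"
      by (auto simp: gate_op_def op_tensor_def a_def b_def id_op_def)
    also have "\<dots> = (\<Sum>pq\<in>?J. if pq = ?p then op_tensor A (a pq) (b pq) x y else 0)"
      using fin p by (simp add: sum.delta)
    also have "\<dots> = (\<Sum>pq\<in>?J. op_tensor A (a pq) (b pq) x y)"
      by (intro sum.cong) (auto simp: op_tensor_def a_def)
    finally show "gate_op g x y = (\<Sum>pq\<in>?J. op_tensor A (a pq) (b pq) x y)" .
  qed
qed

text \<open>A gate that does not cross meets \<open>A\<close> or its complement in the empty set,
  where the count of matrix units is 4^0 = 1. A support inside \<open>A\<close> is reduced to this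
  case by exchanging the two sides.\<close>

lemma op_rank_le_local_gate:
  assumes "local_gate n \<kappa> g"
  shows "op_rank_le S A (if crosses A g then 4 ^ \<kappa> else 1) (gate_op g)"
proof -
  have fin: "finite (fst g)" and card: "card (fst g) \<le> \<kappa>"
    using assms finite_subset[of "fst g" "{..<n}"] by (auto simp: local_gate_def)
  show ?thesis
  proof (cases "crosses A g")
    case True
    have "card (fst g \<inter> A) \<le> \<kappa>"
      using card_mono[OF fin, of "fst g \<inter> A"] card by simp
    then have "op_rank_le S A (4 ^ \<kappa>) (gate_op g)"
      by (intro op_rank_le_mono[OF op_rank_le_gate_op[OF fin]] power_increasing) auto
    with True show ?thesis by simp
  next
    case False
    then have "fst g \<inter> A = {} \<or> fst g \<inter> - A = {}" by (auto simp: crosses_def)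
    then show ?thesis
      using op_rank_le_gate_op[OF fin, of S A] op_rank_le_swap[OF op_rank_le_gate_op[OF fin, of S "- A"]] False
      by auto
  qed
qed

lemma op_rank_le_id: "op_rank_le S A 1 id_op"
  by (rule op_rank_leI[of "{()}" _ _ _ _ "\<lambda>_. id_op" "\<lambda>_. id_op"]) (simp_all add: op_tensor_id)

lemma op_rank_le_layer_op:
  assumes "A \<subseteq> {..<n}" "\<forall>g\<in>set gs. local_gate n \<kappa> g"
  shows "op_rank_le {..<n} A ((4 ^ \<kappa>) ^ length (filter (crosses A) gs)) (layer_op n gs)"
proof -
  have "op_rank_le {..<n} A ((4 ^ \<kappa>) ^ length (filter (crosses A) gs) * K) (fold (\<lambda>g. op_mult {..<n} (gate_op g)) gs U)"
    if "op_rank_le {..<n} A K U" for K U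
    using assms(2) that
  proof (induction gs arbitrary: K U)
    case (Cons g gs)
    have "op_rank_le {..<n} A ((if crosses A g then 4 ^ \<kappa> else 1) * K) (op_mult {..<n} (gate_op g) U)"
      using Cons.prems assms(1) by (intro op_rank_le_mult op_rank_le_local_gate) auto
    from Cons.IH[OF _ this] Cons.prems show ?case
      by (cases "crosses A g") (simp_all add: mult_ac)
  qed simp
  from this[OF op_rank_le_id] show ?thesis
    by (simp add: layer_op_def)
qed

text \<open>Conjugation uses each crossing gate twice, in the layer operator and in its adjoint,
  which squares 4 to 16. Noise does not contribute.\<close>

lemma op_rank_le_noisy_state:
  assumes A: "A \<subseteq> {..<n}"
    and gates: "\<forall>l\<in>{1..L}. (\<forall>g\<in>set (layers l). local_gate n \<kappa> g) \<and> length (filter (crosses A) (layers l)) \<le> B"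
  shows "op_rank_le {..<n} A ((16 ^ \<kappa>) ^ (B * L)) (noisy_state n lam layers L)"
  using gates
proof (induction L)
  case 0
  have "op_tensor A zero_state zero_state = zero_state"
    by (auto simp: op_tensor_def zero_state_def fun_eq_iff)
  then have "op_rank_le {..<n} A 1 zero_state"
    by (intro op_rank_leI[of "{()}" _ _ _ _ "\<lambda>_. zero_state" "\<lambda>_. zero_state"]) simp_all
  then show ?case by simp
next
  case (Suc L)
  let ?X = "noisy_state n lam layers L" and ?U = "layer_op n (layers (Suc L))"
  have prev: "\<forall>l\<in>{1..L}. (\<forall>g\<in>set (layers l). local_gate n \<kappa> g) \<and> length (filter (crosses A) (layers l)) \<le> B"
    using Suc.prems by auto
  have last: "\<forall>g\<in>set (layers (Suc L)). local_gate n \<kappa> g" "length (filter (crosses A) (layers (Suc L))) \<le> B"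
    using Suc.prems by auto
  have "op_rank_le {..<n} A ((4 ^ \<kappa>) ^ length (filter (crosses A) (layers (Suc L)))) ?U"
    by (rule op_rank_le_layer_op[OF A last(1)])
  then have U: "op_rank_le {..<n} A ((4 ^ \<kappa>) ^ B) ?U"
    by (rule op_rank_le_mono) (intro power_increasing last(2), simp)
  have "op_rank_le {..<n} A ((4 ^ \<kappa>) ^ B * (16 ^ \<kappa>) ^ (B * L) * (4 ^ \<kappa>) ^ B) (conj_map n ?U ?X)"
    unfolding conj_map_def using Suc.IH[OF prev] A U
    by (intro op_rank_le_mult op_rank_le_adj) auto
  moreover have "(4 ^ \<kappa>) ^ B * (16 ^ \<kappa>) ^ (B * L) * (4 ^ \<kappa>) ^ B = (16 ^ \<kappa> :: nat) ^ (B * Suc L)"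
  proof -
    have "(4 ^ \<kappa>) ^ B * (4 ^ \<kappa>) ^ B = (16 ^ \<kappa> :: nat) ^ B"
      by (simp add: power_mult_distrib[symmetric])
    then show ?thesis by (simp add: power_add mult_ac)
  qed
  ultimately show ?case
    by (simp add: noisy_layer_def op_rank_le_tensor_power_depol)
qed

section \<open>Schmidt decompositions and truncation errors\<close>

lemma hs_inner_eq_vec_inner:
  "hs_inner S (\<lambda>x y. f (x, y)) (\<lambda>x y. g (x, y)) = vec_inner (Pow S \<times> Pow S) f g"
  by (simp add: hs_inner_eq vec_inner_def sum.cartesian_product)

lemma schmidt_decomposition_exists:
  assumes A: "A \<subseteq> {..<n}" and "op_rank_le {..<n} A K \<rho>"
  shows "\<exists>r s X Y. r \<le> K \<and> schmidt_decomposition n A \<rho> r s X Y"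
proof -
  let ?B = "{..<n} - A"
  let ?P = "Pow A \<times> Pow A" and ?Q = "Pow ?B \<times> Pow ?B"
  obtain I :: "nat set" and a b where I: "finite I" "card I \<le> K"
    and \<rho>: "\<And>x y. x \<in> Pow {..<n} \<Longrightarrow> y \<in> Pow {..<n} \<Longrightarrow> \<rho> x y = (\<Sum>k\<in>I. op_tensor A (a k) (b k) x y)"
    using assms(2) by (rule op_rank_leE) (rule that)
  \<comment> \<open>The realignment of \<open>\<rho>\<close>: rows are matrix positions on
    \<open>A\<close>, columns are matrix positions on the complement. Its singular value
    decomposition is the operator Schmidt decomposition of \<open>\<rho>\<close>.\<close>
  define M where "M p q = \<rho> (fst p \<union> fst q) (snd p \<union> snd q)" for p q :: "nat set \<times> nat set"
  have "finite A" using A finite_subset by blast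
  then have fin: "finite ?P" "finite ?Q" by auto
  have M_sum: "M p q = (\<Sum>k\<in>I. a k (fst p) (snd p) * b k (fst q) (snd q))" if "p \<in> ?P" "q \<in> ?Q" for p q
  proof -
    have "fst p \<union> fst q \<in> Pow {..<n}" "snd p \<union> snd q \<in> Pow {..<n}"
      "(fst p \<union> fst q) \<inter> A = fst p" "(fst p \<union> fst q) - A = fst q"
      "(snd p \<union> snd q) \<inter> A = snd p" "(snd p \<union> snd q) - A = snd q"
      using that A by auto
    then show ?thesis by (simp add: M_def \<rho> op_tensor_def)
  qed
  have "\<exists>r s u v. r \<le> card I \<and> singular_value_decomposition ?P ?Q M r s u v"
    by (rule singular_value_decomposition_exists[OF fin I(1) M_sum])
  then obtain r s u v where r: "r \<le> card I" and svd: "singular_value_decomposition ?P ?Q M r s u v"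
    by blast
  define X where "X \<alpha> = (\<lambda>x y. u \<alpha> (x, y))" for \<alpha>
  define Y where "Y \<alpha> = (\<lambda>x y. v \<alpha> (x, y))" for \<alpha>
  note conjs = svd[unfolded singular_value_decomposition_def]
  note parts = conjs[THEN conjunct1] conjs[THEN conjunct2, THEN conjunct1]
    conjs[THEN conjunct2, THEN conjunct2, THEN conjunct1]
    conjs[THEN conjunct2, THEN conjunct2, THEN conjunct2, THEN conjunct1]
    conjs[THEN conjunct2, THEN conjunct2, THEN conjunct2, THEN conjunct2]
  have svdM: "M p q = (\<Sum>\<alpha>=1..r. of_real (s \<alpha>) * (u \<alpha> p * v \<alpha> q))" if "p \<in> ?P" "q \<in> ?Q" for p q
    using parts(1) that by blast
  have "schmidt_decomposition n A \<rho> r s X Y"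
    unfolding schmidt_decomposition_def
  proof (intro conjI)
    show "op_eq {..<n} \<rho> (schmidt_sum A r s X Y)"
      unfolding op_eq_def
    proof (intro ballI)
      fix x y assume xy: "x \<in> Pow {..<n}" "y \<in> Pow {..<n}"
      have "\<rho> x y = M (x \<inter> A, y \<inter> A) (x - A, y - A)"
        by (simp add: M_def Int_Diff_Un)
      also have "\<dots> = schmidt_sum A r s X Y x y"
        using xy by (subst svdM) (auto simp: schmidt_sum_def op_tensor_def X_def Y_def)
      finally show "\<rho> x y = schmidt_sum A r s X Y x y" .
    qed
    show "hs_orthonormal A {1..r} X"
      using parts(4) unfolding hs_orthonormal_def X_def hs_inner_eq_vec_inner .
    show "hs_orthonormal ?B {1..r} Y"
      using parts(5) unfolding hs_orthonormal_def Y_def hs_inner_eq_vec_inner .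
  qed (rule parts)+
  moreover have "r \<le> K" using r I(2) by simp
  ultimately show ?thesis by blast
qed

text \<open>The decomposition found has at most \<open>K\<close> terms, so nothing is cut off and
  the error is zero.\<close>

lemma trunc_error_le_rank:
  assumes "A \<subseteq> {..<n}" "op_rank_le {..<n} A K \<rho>" "0 \<le> t"
  shows "trunc_error_le n A \<rho> K t"
proof -
  obtain r s X Y where r: "r \<le> K" and sd: "schmidt_decomposition n A \<rho> r s X Y"
    using schmidt_decomposition_exists[OF assms(1,2)] by blast
  have "op_eq {..<n} (\<lambda>x y. \<rho> x y - schmidt_sum A (min K r) s X Y x y) (\<lambda>x y. 0)"
    using sd r by (simp add: schmidt_decomposition_def op_eq_def min_absorb2)
  then have "hs_norm {..<n} (\<lambda>x y. \<rho> x y - schmidt_sum A (min K r) s X Y x y) = hs_norm {..<n} (\<lambda>x y. 0)"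
    by (rule hs_norm_cong)
  also have "\<dots> = 0" by (simp add: hs_norm_def hs_inner_eq)
  finally have "(hs_norm {..<n} (\<lambda>x y. \<rho> x y - schmidt_sum A (min K r) s X Y x y))\<^sup>2 \<le> t"
    using assms(3) by simp
  with sd show ?thesis unfolding trunc_error_le_def by blast
qed

lemma hs_bessel:
  assumes "finite J" "hs_orthonormal S J X"
  shows "(\<Sum>\<alpha>\<in>J. (cmod (hs_inner S (X \<alpha>) W))\<^sup>2) \<le> (hs_norm S W)\<^sup>2"
  using assms
proof (induction J arbitrary: W rule: finite_induct)
  case (insert j J)
  let ?c = "hs_inner S (X j) W"
  define W' where "W' = (\<lambda>x y. W x y - ?c * X j x y)"
  have orth: "hs_inner S (X \<alpha>) (X j) = (if \<alpha> = j then 1 else 0)" if "\<alpha> \<in> insert j J" for \<alpha>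
    by (rule insert.prems[unfolded hs_orthonormal_def, rule_format, OF that insertI1])
  have "hs_inner S (X \<alpha>) W' = hs_inner S (X \<alpha>) W" if "\<alpha> \<in> J" for \<alpha>
    using that insert.hyps orth[of \<alpha>] by (auto simp: W'_def hs_inner_diff_right hs_inner_scale_right)
  moreover have "(\<Sum>\<alpha>\<in>J. (cmod (hs_inner S (X \<alpha>) W'))\<^sup>2) \<le> (hs_norm S W')\<^sup>2"
    using insert.prems by (intro insert.IH) (simp add: hs_orthonormal_def)
  moreover have "(hs_norm S W')\<^sup>2 = (hs_norm S W)\<^sup>2 - (cmod ?c)\<^sup>2"
  proof -
    have "hs_inner S W (X j) = cnj ?c" by (rule hs_inner_commute)
    then have "hs_inner S W' W' = hs_inner S W W - ?c * cnj ?c"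
      using orth[of j]
      by (simp add: W'_def hs_inner_diff_right hs_inner_diff_left hs_inner_scale_right hs_inner_scale_left)
    then have "complex_of_real ((hs_norm S W')\<^sup>2) = of_real ((hs_norm S W)\<^sup>2 - (cmod ?c)\<^sup>2)"
      unfolding hs_inner_self_norm complex_norm_square[symmetric] by simp
    then show ?thesis by (simp only: of_real_eq_iff)
  qed
  ultimately show ?case using insert.hyps by simp
qed simp

text \<open>The trace is the overlap with the identity, a product of identities. Replacing every
  coefficient by the largest one, then using Cauchy-Schwarz and Bessel on each side of the cut,
  gives 1 <= \<open>s 1 * sqrt (2 ^ n)\<close>. Keeping only the first term leaves the squared error
  |\<rho>|^2 - (s 1)^2, and the lower bound on \<open>s 1\<close> finishes.\<close>

lemma trunc_error_le_one:
  assumes A: "A \<subseteq> {..<n}" and rank: "op_rank_le {..<n} A K \<rho>" and tr: "op_tr {..<n} \<rho> = 1"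
    and t: "(hs_norm {..<n} \<rho>)\<^sup>2 - 1 / 2 ^ n \<le> t"
  shows "trunc_error_le n A \<rho> 1 t"
proof -
  let ?S = "{..<n}"
  let ?B = "?S - A"
  have S: "finite ?S" and fin: "finite A" "finite ?B" using A finite_subset by auto
  obtain r s X Y where sd: "schmidt_decomposition n A \<rho> r s X Y"
    using schmidt_decomposition_exists[OF A rank] by blast
  have \<rho>: "op_eq ?S \<rho> (schmidt_sum A r s X Y)"
    and pos: "\<And>\<alpha>. \<alpha> \<in> {1..r} \<Longrightarrow> 0 < s \<alpha>"
    and sorted: "\<And>\<alpha> \<beta>. \<alpha> \<in> {1..r} \<Longrightarrow> \<beta> \<in> {1..r} \<Longrightarrow> \<alpha> \<le> \<beta> \<Longrightarrow> s \<beta> \<le> s \<alpha>"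
    and orthX: "hs_orthonormal A {1..r} X" and orthY: "hs_orthonormal ?B {1..r} Y"
    using sd unfolding schmidt_decomposition_def by blast+
  have inner: "hs_inner ?S Z \<rho> = (\<Sum>\<alpha>=1..r. of_real (s \<alpha>) * hs_inner ?S Z (op_tensor A (X \<alpha>) (Y \<alpha>)))" for Z
  proof -
    have "hs_inner ?S Z \<rho> = hs_inner ?S Z (schmidt_sum A r s X Y)"
      by (intro hs_inner_cong op_eq_refl \<rho>)
    also have "\<dots> = (\<Sum>x\<in>Pow ?S. \<Sum>y\<in>Pow ?S. \<Sum>\<alpha>=1..r. of_real (s \<alpha>) * (cnj (Z x y) * op_tensor A (X \<alpha>) (Y \<alpha>) x y))"
      unfolding hs_inner_eq schmidt_sum_def sum_distrib_left by (simp add: mult_ac)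
    also have "\<dots> = (\<Sum>x\<in>Pow ?S. \<Sum>\<alpha>=1..r. \<Sum>y\<in>Pow ?S. of_real (s \<alpha>) * (cnj (Z x y) * op_tensor A (X \<alpha>) (Y \<alpha>) x y))"
      by (intro sum.cong refl sum.swap)
    also have "\<dots> = (\<Sum>\<alpha>=1..r. \<Sum>x\<in>Pow ?S. \<Sum>y\<in>Pow ?S. of_real (s \<alpha>) * (cnj (Z x y) * op_tensor A (X \<alpha>) (Y \<alpha>) x y))"
      by (rule sum.swap)
    finally show ?thesis unfolding hs_inner_eq sum_distrib_left .
  qed
  have "1 \<le> r"
  proof (rule ccontr)
    assume "\<not> 1 \<le> r"
    then have "hs_inner ?S id_op \<rho> = 0" unfolding inner by simp
    then show False using tr op_tr_eq_hs_inner_id[OF S, of \<rho>] by simp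
  qed
  then have r1: "1 \<in> {1..r}" by simp
  define a where "a \<alpha> = cmod (hs_inner A (X \<alpha>) id_op)" for \<alpha>
  define b where "b \<alpha> = cmod (hs_inner ?B (Y \<alpha>) id_op)" for \<alpha>
  have ab: "cmod (hs_inner ?S id_op (op_tensor A (X \<alpha>) (Y \<alpha>))) = a \<alpha> * b \<alpha>" for \<alpha>
  proof -
    have "hs_inner ?S id_op (op_tensor A (X \<alpha>) (Y \<alpha>)) = hs_inner A id_op (X \<alpha>) * hs_inner ?B id_op (Y \<alpha>)"
      by (subst op_tensor_id[of A, symmetric]) (rule hs_inner_tensor[OF S A])
    then show ?thesis
      unfolding a_def b_def by (metis complex_mod_cnj hs_inner_commute norm_mult)
  qed
  have "1 = cmod (hs_inner ?S id_op \<rho>)"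
    using tr op_tr_eq_hs_inner_id[OF S, of \<rho>] by simp
  also have "\<dots> \<le> (\<Sum>\<alpha>=1..r. cmod (of_real (s \<alpha>) * hs_inner ?S id_op (op_tensor A (X \<alpha>) (Y \<alpha>))))"
    unfolding inner by (rule norm_sum)
  also have "\<dots> = (\<Sum>\<alpha>=1..r. s \<alpha> * (a \<alpha> * b \<alpha>))"
    unfolding norm_mult ab using pos by (intro sum.cong refl) (simp add: less_imp_le)
  also have "\<dots> \<le> (\<Sum>\<alpha>=1..r. s 1 * (a \<alpha> * b \<alpha>))"
    using sorted r1 by (intro sum_mono mult_right_mono) (auto simp: a_def b_def)
  also have "\<dots> = s 1 * (\<Sum>\<alpha>=1..r. \<bar>a \<alpha>\<bar> * \<bar>b \<alpha>\<bar>)"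
    by (simp add: sum_distrib_left a_def b_def)
  also have "\<dots> \<le> s 1 * (L2_set a {1..r} * L2_set b {1..r})"
    using pos[OF r1] by (intro mult_left_mono L2_set_mult_ineq) simp
  also have "\<dots> \<le> s 1 * (sqrt (2 ^ card A) * sqrt (2 ^ card ?B))"
  proof (intro mult_left_mono mult_mono)
    show "L2_set a {1..r} \<le> sqrt (2 ^ card A)"
      using hs_bessel[OF _ orthX, of id_op] hs_norm_id[OF fin(1)] by (simp add: L2_set_def a_def)
    show "L2_set b {1..r} \<le> sqrt (2 ^ card ?B)"
      using hs_bessel[OF _ orthY, of id_op] hs_norm_id[OF fin(2)] by (simp add: L2_set_def b_def)
  qed (use pos[OF r1] in \<open>auto intro: less_imp_le\<close>)
  also have "\<dots> = s 1 * sqrt (2 ^ n)"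
  proof -
    have "card A + card ?B = n"
      using card_Diff_subset[OF fin(1) A] card_mono[OF S A] by simp
    then show ?thesis by (simp add: real_sqrt_mult[symmetric] power_add[symmetric])
  qed
  finally have "1\<^sup>2 \<le> (s 1 * sqrt (2 ^ n))\<^sup>2"
    by (intro power_mono) auto
  then have s1: "1 / 2 ^ n \<le> (s 1)\<^sup>2"
    by (simp add: power_mult_distrib field_simps)
  define Z where "Z = op_tensor A (X 1) (Y 1)"
  have ZX: "hs_inner ?S Z (op_tensor A (X \<alpha>) (Y \<alpha>)) = (if \<alpha> = 1 then 1 else 0)" if "\<alpha> \<in> {1..r}" for \<alpha>
    using orthX orthY r1 that unfolding Z_def hs_inner_tensor[OF S A] hs_orthonormal_def by auto
  have Z\<rho>: "hs_inner ?S Z \<rho> = of_real (s 1)"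
  proof -
    have "hs_inner ?S Z \<rho> = (\<Sum>\<alpha>=1..r. if \<alpha> = 1 then of_real (s \<alpha>) else 0)"
      unfolding inner by (intro sum.cong refl) (simp add: ZX)
    then show ?thesis using r1 by (simp add: sum.delta)
  qed
  have trunc: "schmidt_sum A (min 1 r) s X Y = (\<lambda>x y. of_real (s 1) * Z x y)"
    using \<open>1 \<le> r\<close> by (simp add: schmidt_sum_def Z_def min_absorb1)
  have "hs_inner ?S (\<lambda>x y. \<rho> x y - of_real (s 1) * Z x y) (\<lambda>x y. \<rho> x y - of_real (s 1) * Z x y)
      = hs_inner ?S \<rho> \<rho> - of_real ((s 1)\<^sup>2)"
    using ZX[OF r1, folded Z_def] Z\<rho> hs_inner_commute[of ?S \<rho> Z]
    by (simp add: hs_inner_diff_left hs_inner_diff_right hs_inner_scale_left hs_inner_scale_right power2_eq_square)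
  then have "complex_of_real ((hs_norm ?S (\<lambda>x y. \<rho> x y - of_real (s 1) * Z x y))\<^sup>2) = of_real ((hs_norm ?S \<rho>)\<^sup>2 - (s 1)\<^sup>2)"
    unfolding hs_inner_self_norm by simp
  then have "(hs_norm ?S (\<lambda>x y. \<rho> x y - of_real (s 1) * Z x y))\<^sup>2 = (hs_norm ?S \<rho>)\<^sup>2 - (s 1)\<^sup>2"
    by (simp only: of_real_eq_iff)
  then have "(hs_norm ?S (\<lambda>x y. \<rho> x y - schmidt_sum A (min 1 r) s X Y x y))\<^sup>2 \<le> t"
    unfolding trunc using t s1 by simp
  with sd show ?thesis unfolding trunc_error_le_def by blast
qed

section \<open>Bond dimensions\<close>

text \<open>A \<open>LEAST\<close> says something only once an admissible value is known, so even
  the lower bound 1 takes the witness \<open>R0\<close>.\<close>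

lemma R_abs_bounds:
  assumes "1 \<le> R0" "trunc_error_le n A \<rho> R0 \<epsilon>"
  shows "1 \<le> R_abs n A \<epsilon> \<rho>" "R_abs n A \<epsilon> \<rho> \<le> R0"
  using LeastI[of "\<lambda>R0. 1 \<le> R0 \<and> trunc_error_le n A \<rho> R0 \<epsilon>" R0]
    Least_le[of "\<lambda>R0. 1 \<le> R0 \<and> trunc_error_le n A \<rho> R0 \<epsilon>" R0] assms
  unfolding R_abs_def by simp_all

lemma R_rel_bounds:
  assumes "1 \<le> R0" "trunc_error_le n A \<rho> R0 (\<delta> * (hs_norm {..<n} \<rho>)\<^sup>2)"
  shows "1 \<le> R_rel n A \<delta> \<rho>" "R_rel n A \<delta> \<rho> \<le> R0"
  using LeastI[of "\<lambda>R0. 1 \<le> R0 \<and> trunc_error_le n A \<rho> R0 (\<delta> * (hs_norm {..<n} \<rho>)\<^sup>2)" R0]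
    Least_le[of "\<lambda>R0. 1 \<le> R0 \<and> trunc_error_le n A \<rho> R0 (\<delta> * (hs_norm {..<n} \<rho>)\<^sup>2)" R0] assms
  unfolding R_rel_def by simp_all

text \<open>Taking the root of order \<open>a\<close> cancels the factor \<open>a\<close> in the
  exponent. The polynomial is n raised to C rounded up.\<close>

lemma bond_dimension_bounds:
  fixes C a :: real and n R :: nat
  assumes "0 < a" "1 \<le> R" "ln (real R) \<le> C * a * ln (real n)" "2 \<le> n"
  shows "ln (real R powr (1 / a)) \<le> C * ln (real n)"
    and "real R powr (1 / a) \<le> poly (monom 1 (nat \<lceil>C\<rceil>)) (real n)"
proof -
  show ln: "ln (real R powr (1 / a)) \<le> C * ln (real n)"
    using assms by (simp add: ln_powr divide_le_eq mult_ac)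
  have "real R powr (1 / a) = exp (ln (real R powr (1 / a)))"
    using assms by (intro exp_ln[symmetric]) simp
  also have "\<dots> \<le> exp (C * ln (real n))" using ln by simp
  also have "\<dots> = real n powr C" using assms by (simp add: powr_def)
  also have "\<dots> \<le> real n powr real (nat \<lceil>C\<rceil>)"
    using assms by (intro powr_mono) linarith+
  also have "\<dots> = poly (monom 1 (nat \<lceil>C\<rceil>)) (real n)"
    using assms by (simp add: powr_realpow poly_monom)
  finally show "real R powr (1 / a) \<le> poly (monom 1 (nat \<lceil>C\<rceil>)) (real n)" .
qed

text \<open>The logarithm of the last hypothesis, with the additive constant absorbed: as
  \<open>n\<close> is at least 2, \<open>ln (real n) / ln 2\<close> is at least 1, and multiplying
  \<open>\<bar>ln \<eta>\<bar>\<close> by it leaves a pure multiple of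
  \<open>ln (real n)\<close>.\<close>

lemma shallow_depth_bound:
  fixes \<gamma> \<eta> :: real and n L :: nat
  assumes "0 < \<gamma>" "\<gamma> < 1" "0 < \<eta>" "2 \<le> n" "\<eta> < real n * \<gamma> ^ L"
  shows "real L \<le> (1 + \<bar>ln \<eta>\<bar> / ln 2) / (- ln \<gamma>) * ln (real n)"
proof -
  have "ln \<eta> < ln (real n * \<gamma> ^ L)"
    using assms by (subst ln_less_cancel_iff) auto
  also have "\<dots> = ln (real n) + real L * ln \<gamma>"
    using assms by (simp add: ln_mult ln_realpow)
  finally have "real L * (- ln \<gamma>) \<le> ln (real n) + \<bar>ln \<eta>\<bar> * 1" by simp
  also have "\<dots> \<le> ln (real n) + \<bar>ln \<eta>\<bar> * (ln (real n) / ln 2)"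
    using assms by (intro add_left_mono mult_left_mono) (auto simp: field_simps)
  finally have "real L * (- ln \<gamma>) \<le> (1 + \<bar>ln \<eta>\<bar> / ln 2) * ln (real n)"
    by (simp add: algebra_simps)
  moreover have "0 < - ln \<gamma>" using assms by simp
  ultimately show ?thesis
    unfolding times_divide_eq_left by (simp only: pos_le_divide_eq)
qed

text \<open>The constant is obtained before \<open>n\<close>, the cut, the circuit and the depth are
  introduced, which gives the required uniformity. The two depth regimes are separated by comparing
  \<open>real n * \<gamma> ^ L\<close> with \<open>\<eta>\<close>.\<close>

lemma schmidt_rank_bounds:
  fixes lam \<epsilon> \<delta> C\<^sub>b :: real and \<kappa> :: nat
  assumes lam: "0 < lam" "lam \<le> 1" and eps: "0 < \<epsilon>" and del: "0 < \<delta>" "\<delta> < 1" and "1 \<le> \<kappa>" "0 < C\<^sub>b"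
  obtains C where "0 < C"
    "\<And>n A layers L a. 2 \<le> n \<Longrightarrow> A \<subseteq> {..<n} \<Longrightarrow> 0 < a \<Longrightarrow>
      \<forall>l\<in>{1..L}. (\<forall>g\<in>set (layers l). local_gate n \<kappa> g) \<and>
        real (length (filter (crosses A) (layers l))) \<le> C\<^sub>b * a \<Longrightarrow>
      1 \<le> R_abs n A \<epsilon> (noisy_state n lam layers L) \<and>
      1 \<le> R_rel n A \<delta> (noisy_state n lam layers L) \<and>
      ln (real (R_abs n A \<epsilon> (noisy_state n lam layers L))) \<le> C * a * ln (real n) \<and>
      ln (real (R_rel n A \<delta> (noisy_state n lam layers L))) \<le> C * a * ln (real n)"
proof -
  \<comment> \<open>One tolerance serves both errors: \<theta> |\<rho>|^2 is at most \<delta>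
    |\<rho>|^2, and at most \<epsilon> because |\<rho>|^2 <= 1.\<close>
  define \<theta> where "\<theta> = min \<epsilon> \<delta>"
  have \<theta>: "0 < \<theta>" "\<theta> < 1" "\<theta> \<le> \<epsilon>" "\<theta> \<le> \<delta>" using eps del by (auto simp: \<theta>_def)
  define \<eta> where "\<eta> = log 2 (1 + \<theta>)"
  have \<eta>: "0 < \<eta>" "2 powr \<eta> = 1 + \<theta>" using \<theta> by (simp_all add: \<eta>_def)
  \<comment> \<open>1/3 is a convenient value whose square, 1/9, is below 1/8. The same
    \<open>m\<close> serves as the number of squarings, because
    \<open>m \<le> 2 ^ Suc m\<close>.\<close>
  obtain m where m: "(1 - lam) ^ m < 1 / 3"
    using real_arch_pow_inv[of "1 / 3" "1 - lam"] lam by auto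
  have "((1 - lam) ^ 2 ^ Suc m)\<^sup>2 \<le> 1 / 8"
  proof -
    have "m \<le> 2 ^ Suc m" using less_exp[of "Suc m"] by linarith
    then have "(1 - lam) ^ 2 ^ Suc m \<le> (1 - lam) ^ m"
      using lam by (intro power_decreasing) auto
    then have "((1 - lam) ^ 2 ^ Suc m)\<^sup>2 \<le> (1 / 3)\<^sup>2"
      using m lam by (intro power_mono) auto
    then show ?thesis by (simp add: power2_eq_square)
  qed
  note purity = noisy_state_purity[OF lam this]
  define \<gamma> :: real where "\<gamma> = 1 - (1 / 2) ^ m / 4"
  have "(1 / 2 :: real) ^ m \<le> 1" "0 < (1 / 2 :: real) ^ m" by (simp_all add: power_le_one)
  then have \<gamma>: "0 < \<gamma>" "\<gamma> < 1" by (simp_all add: \<gamma>_def)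
  define D where "D = (1 + \<bar>ln \<eta>\<bar> / ln 2) / (- ln \<gamma>)"
  have D: "0 < D" unfolding D_def using \<gamma> by (intro divide_pos_pos add_pos_nonneg) auto
  \<comment> \<open>At most \<open>D * ln (real n)\<close> layers, each with at most
    \<open>C\<^sub>b * a\<close> crossing gates, each adding \<open>real \<kappa> * ln 16\<close> to
    the logarithm of the rank.\<close>
  define C where "C = C\<^sub>b * (real \<kappa> * ln 16) * D"
  have C: "0 < C" using D assms by (simp add: C_def)
  show thesis
  proof (rule that[OF C])
    fix n :: nat and A and layers :: "nat \<Rightarrow> gate list" and L and a :: real
    assume n: "2 \<le> n" and A: "A \<subseteq> {..<n}" and a: "0 < a"
      and gates: "\<forall>l\<in>{1..L}. (\<forall>g\<in>set (layers l). local_gate n \<kappa> g) \<and>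
        real (length (filter (crosses A) (layers l))) \<le> C\<^sub>b * a"
    define \<rho> where "\<rho> = noisy_state n lam layers L"
    define B where "B = nat \<lfloor>C\<^sub>b * a\<rfloor>"
    define K :: nat where "K = (16 ^ \<kappa>) ^ (B * L)"
    have B: "real B \<le> C\<^sub>b * a" using a assms(7) by (simp add: B_def)
    have "\<forall>l\<in>{1..L}. (\<forall>g\<in>set (layers l). local_gate n \<kappa> g) \<and> length (filter (crosses A) (layers l)) \<le> B"
      using gates by (simp add: B_def le_nat_floor)
    then have rank: "op_rank_le {..<n} A K \<rho>"
      unfolding K_def \<rho>_def by (rule op_rank_le_noisy_state[OF A])
    have K: "1 \<le> K" by (simp add: K_def)
    have "\<forall>l\<in>{1..L}. \<forall>g\<in>set (layers l). local_gate n \<kappa> g" using gates by blast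
    from purity[OF this] have tr: "op_tr {..<n} \<rho> = 1"
      and pur: "2 ^ n * (hs_norm {..<n} \<rho>)\<^sup>2 \<le> 2 powr (real n * \<gamma> ^ L)"
      unfolding \<rho>_def \<gamma>_def by blast+
    have ln_n: "0 \<le> ln (real n)" using n by simp
    have bound: "\<exists>R0\<ge>1. ln (real R0) \<le> C * a * ln (real n) \<and> trunc_error_le n A \<rho> R0 \<epsilon>
        \<and> trunc_error_le n A \<rho> R0 (\<delta> * (hs_norm {..<n} \<rho>)\<^sup>2)"
    proof (cases "real n * \<gamma> ^ L \<le> \<eta>")
      case True
      have "2 powr (real n * \<gamma> ^ L) \<le> 2 powr \<eta>" using True by (intro powr_mono) auto
      then have f: "2 ^ n * (hs_norm {..<n} \<rho>)\<^sup>2 \<le> 1 + \<theta>" using pur \<eta>(2) by linarith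
      \<comment> \<open>From f <= 1 + \<theta> follows f (1 - \<theta>) <= 1 - \<theta>^2 <= 1, that
        is f - 1 <= \<theta> f. Divided by 2^n this is an error bound relative to
        |\<rho>|^2.\<close>
      have "(2 ^ n * (hs_norm {..<n} \<rho>)\<^sup>2) * (1 - \<theta>) \<le> (1 + \<theta>) * (1 - \<theta>)"
        using f \<theta> by (intro mult_right_mono) auto
      also have "\<dots> \<le> 1" by (simp add: algebra_simps)
      finally have "2 ^ n * ((hs_norm {..<n} \<rho>)\<^sup>2 * (1 - \<theta>)) \<le> 1" by (simp add: mult.assoc)
      then have "(hs_norm {..<n} \<rho>)\<^sup>2 * (1 - \<theta>) \<le> 1 / 2 ^ n"
        by (simp add: pos_le_divide_eq mult.commute)
      then have err: "(hs_norm {..<n} \<rho>)\<^sup>2 - 1 / 2 ^ n \<le> \<theta> * (hs_norm {..<n} \<rho>)\<^sup>2"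
        by (simp add: algebra_simps)
      \<comment> \<open>The purity bound also yields |\<rho>|^2 <= 1, which turns the relative error
        into an absolute one.\<close>
      have "real n * \<gamma> ^ L \<le> real n * 1"
        using \<gamma> by (intro mult_left_mono power_le_one) auto
      then have "2 powr (real n * \<gamma> ^ L) \<le> 2 ^ n"
        by (simp flip: powr_realpow)
      then have "2 ^ n * (hs_norm {..<n} \<rho>)\<^sup>2 \<le> 2 ^ n * 1" using pur by linarith
      then have "(hs_norm {..<n} \<rho>)\<^sup>2 \<le> 1" by (subst (asm) mult_le_cancel_left_pos) auto
      then have "\<theta> * (hs_norm {..<n} \<rho>)\<^sup>2 \<le> \<epsilon> * 1"
        using \<theta> eps by (intro mult_mono) auto
      moreover have "\<theta> * (hs_norm {..<n} \<rho>)\<^sup>2 \<le> \<delta> * (hs_norm {..<n} \<rho>)\<^sup>2"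
        using \<theta> by (intro mult_right_mono) auto
      ultimately have "trunc_error_le n A \<rho> 1 \<epsilon>" "trunc_error_le n A \<rho> 1 (\<delta> * (hs_norm {..<n} \<rho>)\<^sup>2)"
        using err by (intro trunc_error_le_one[OF A rank tr]; linarith)+
      moreover have "ln (real 1) \<le> C * a * ln (real n)" using C a ln_n by simp
      ultimately show ?thesis by blast
    next
      case False
      have "trunc_error_le n A \<rho> K \<epsilon>" "trunc_error_le n A \<rho> K (\<delta> * (hs_norm {..<n} \<rho>)\<^sup>2)"
        using eps del by (intro trunc_error_le_rank[OF A rank]; simp)+
      moreover have "ln (real K) \<le> C * a * ln (real n)"
      proof -
        have "real L \<le> D * ln (real n)"
          unfolding D_def using False by (intro shallow_depth_bound \<gamma> \<eta> n) simp
        then have "real B * real L \<le> (C\<^sub>b * a) * (D * ln (real n))"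
          using B a assms(7) by (intro mult_mono) auto
        then have "(real B * real L) * (real \<kappa> * ln 16) \<le> (C\<^sub>b * a) * (D * ln (real n)) * (real \<kappa> * ln 16)"
          by (rule mult_right_mono) simp
        moreover have "ln (real K) = (real B * real L) * (real \<kappa> * ln 16)"
          by (simp add: K_def ln_realpow)
        ultimately show ?thesis by (simp add: C_def mult_ac)
      qed
      ultimately show ?thesis using K by blast
    qed
    then obtain R0 where R0: "1 \<le> R0" "ln (real R0) \<le> C * a * ln (real n)"
      "trunc_error_le n A \<rho> R0 \<epsilon>" "trunc_error_le n A \<rho> R0 (\<delta> * (hs_norm {..<n} \<rho>)\<^sup>2)"
      by blast
    note abs = R_abs_bounds[OF R0(1,3)] and rel = R_rel_bounds[OF R0(1,4)]
    have ln_le: "ln (real R) \<le> C * a * ln (real n)" if "1 \<le> R" "R \<le> R0" for R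
    proof -
      have "ln (real R) \<le> ln (real R0)" using that by simp
      then show ?thesis using R0(2) by linarith
    qed
    show "1 \<le> R_abs n A \<epsilon> (noisy_state n lam layers L) \<and>
      1 \<le> R_rel n A \<delta> (noisy_state n lam layers L) \<and>
      ln (real (R_abs n A \<epsilon> (noisy_state n lam layers L))) \<le> C * a * ln (real n) \<and>
      ln (real (R_rel n A \<delta> (noisy_state n lam layers L))) \<le> C * a * ln (real n)"
      unfolding \<rho>_def[symmetric] using abs rel ln_le[OF abs] ln_le[OF rel] by simp
  qed
qed

theorem corollary6:
  fixes lam \<epsilon> \<delta> C\<^sub>b :: real and \<kappa> :: nat
  assumes "0 < lam" "lam \<le> 1" "0 < \<epsilon>" "0 < \<delta>" "\<delta> < 1" "1 \<le> \<kappa>" "0 < C\<^sub>b"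
  shows "\<exists>C>0. \<exists>p :: real poly.
    \<forall>(n::nat) (E :: nat set set) (d::nat) (A :: nat set) (layers :: nat \<Rightarrow> gate list) (L::nat).
      2 \<le> n \<longrightarrow> simple_graph n E \<longrightarrow> degree_bounded n E d \<longrightarrow>
      A \<subseteq> {..<n} \<longrightarrow> 0 < boundary_size E A \<longrightarrow>
      (\<forall>l\<in>{1..L}. (\<forall>g\<in>set (layers l). local_gate n \<kappa> g) \<and>
         real (length (filter (crosses A) (layers l))) \<le> C\<^sub>b * real (boundary_size E A)) \<longrightarrow>
      (let \<rho> = noisy_state n lam layers L in
         ln (bond_dim_abs n E A \<epsilon> \<rho>) \<le> C * ln (real n) \<and>
         ln (bond_dim_rel n E A \<delta> \<rho>) \<le> C * ln (real n) \<and>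
         bond_dim_abs n E A \<epsilon> \<rho> \<le> poly p (real n) \<and>
         bond_dim_rel n E A \<delta> \<rho> \<le> poly p (real n))"
proof (rule schmidt_rank_bounds[OF assms], rule exI, intro conjI exI allI impI)
  fix C :: real
  assume "0 < C"
  then show "0 < C" .
next
  fix C :: real and n E and d :: nat and A and layers :: "nat \<Rightarrow> gate list" and L
  assume bounds: "\<And>n A layers L a. 2 \<le> n \<Longrightarrow> A \<subseteq> {..<n} \<Longrightarrow> 0 < a \<Longrightarrow>
      \<forall>l\<in>{1..L}. (\<forall>g\<in>set (layers l). local_gate n \<kappa> g) \<and>
        real (length (filter (crosses A) (layers l))) \<le> C\<^sub>b * a \<Longrightarrow>
      1 \<le> R_abs n A \<epsilon> (noisy_state n lam layers L) \<and>
      1 \<le> R_rel n A \<delta> (noisy_state n lam layers L) \<and>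
      ln (real (R_abs n A \<epsilon> (noisy_state n lam layers L))) \<le> C * a * ln (real n) \<and>
      ln (real (R_rel n A \<delta> (noisy_state n lam layers L))) \<le> C * a * ln (real n)"
    and n: "2 \<le> n" and A: "A \<subseteq> {..<n}" and bd: "0 < boundary_size E A"
    and gates: "\<forall>l\<in>{1..L}. (\<forall>g\<in>set (layers l). local_gate n \<kappa> g) \<and>
         real (length (filter (crosses A) (layers l))) \<le> C\<^sub>b * real (boundary_size E A)"
  have a: "0 < real (boundary_size E A)" using bd by simp
  note R = bounds[OF n A a gates]
  \<comment> \<open>The polynomial was left schematic by \<open>exI\<close> and is fixed here; it
    depends on \<open>C\<close> alone.\<close>
  show "let \<rho> = noisy_state n lam layers L in
         ln (bond_dim_abs n E A \<epsilon> \<rho>) \<le> C * ln (real n) \<and>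
         ln (bond_dim_rel n E A \<delta> \<rho>) \<le> C * ln (real n) \<and>
         bond_dim_abs n E A \<epsilon> \<rho> \<le> poly (monom 1 (nat \<lceil>C\<rceil>)) (real n) \<and>
         bond_dim_rel n E A \<delta> \<rho> \<le> poly (monom 1 (nat \<lceil>C\<rceil>)) (real n)"
    unfolding Let_def bond_dim_abs_def bond_dim_rel_def
    using R bond_dimension_bounds[OF a _ _ n] by blast
qed

end
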